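(* Let $\Gamma$ be a graph of type $A_n$ with $n\ge 2$. List all sources and sinks of $\Gamma$ in the order in which they occur along the underlying path as $a_0,a_1,\dots,a_{k+1}$ (so $a_0$ and $a_{k+1}$ are the two end vertices and $k\ge 0$ is the number of internal sources and sinks). For $1\le i\le k+1$ let $\Gamma_i$ be the full subgraph of $\Gamma$ on the vertices from $a_{i-1}$ to $a_i$ (inclusive), and let $l_i$ be its number of vertices. Let $C_m=\frac{1}{m+1}\binom{2m}{m}$ denote the Catalan numbers. Then: (i) $|\mathfrak{m}(\Gamma)|=\prod_{i=1}^{k+1}C_{l_i}$, where $\mathfrak{m}(\Gamma)\subset HK_\Gamma$ is the set of elements of maximal content. (ii) If $k\ge 1$, then $|HK_\Gamma|=\sum_{Q\subset\{1,\dots,k\}}\prod_{i=1}^{k+1}c_i(Q)$, where, with $\delta_i(Q)=1$ if $i\in Q$ and $\delta_i(Q)=0$ otherwise, for $2\le i\le k$ \[c_i(Q)=\begin{cases} C_{l_i-1}, & \delta_{i-1}(Q)=\delta_i(Q)=0;\\ C_{l_i}-C_{l_i-1}, & \delta_{i-1}(Q)+\delta_i(Q)=1;\\ C_{l_i+1}-2C_{l_i}+C_{l_i-1}, & \delta_{i-1}(Q)=\delta_i(Q)=1,\end{cases}\] and \[c_1(Q)=\begin{cases} C_{l_1}, & \delta_1(Q)=0;\\ C_{l_1+1}-C_{l_1}, & \delta_1(Q)=1;\end{cases}\qquad c_{k+1}(Q)=\begin{cases} C_{l_{k+1}}, & \delta_k(Q)=0;\\ C_{l_{k+1}+1}-C_{l_{k+1}},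 & \delta_k(Q)=1.\end{cases}\] (iii) If $\Gamma$ is a graph of type $A_n$ with $n\geq 1$ in which every vertex is a source or a sink (that is, $1\to 2\leftarrow 3\to 4\leftarrow\cdots n$ or $1\leftarrow 2\to 3\leftarrow 4\to\cdots n$), then $|HK_\Gamma|=F_{2n+1}$, the $(2n+1)$-th Fibonacci number (where $F_1=F_2=1$).
   Context: A graph of type $A_n$ is a directed graph with vertices $v_1,\dots,v_n$ such that for each $i\in\{1,\dots,n-1\}$ there is exactly one directed edge between $v_i$ and $v_{i+1}$ (in either direction), and there are no other edges. A source is a vertex with no incoming edges, a sink is a vertex with no outgoing edges. For a finite directed graph $\Gamma$ without loops and with at most one directed edge between any pair of vertices, the Hecke-Kiselman monoid $HK_\Gamma$ is the quotient of the free monoid $V(\Gamma)^*$ on the vertex set by the relations: $x^2=x$ for all $x\in V(\Gamma)$; $xy=yx$ if there is no edge between $x$ and $y$; $xyx=yxy=xy$ if there is an edge $x\to y$. The class of a word $\mathbf{w}$ is $[\mathbf{w}]$. The content $\mathfrak{c}[\mathbf{w}]\subset V(\Gamma)$ is the set of vertices occurring in $\mathbf{w}$ (this depends only on $[\mathbf{w}]$). An element $[\mathbf{w}]$ has maximal content if $\mathfrak{c}[\mathbf{w}]=V(\Gamma)$. *)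

theory Defs
  imports
    "Graph_Theory.Digraph_Component"
    "Graph_Theory.Pair_Digraph"
    "HOL-Algebra.Group"
    "HOL-Number_Theory.Fib"
begin

section \<open>Graphs of type A\<close>

definition type_A :: "'a pair_pre_digraph \<Rightarrow> (nat \<Rightarrow> 'a) \<Rightarrow> nat \<Rightarrow> bool" where
  "type_A G v n \<longleftrightarrow>
     inj_on v {1..n} \<and> pverts G = v ` {1..n} \<and>
     (\<forall>i\<in>{1..<n}. ((v i, v (i + 1)) \<in> parcs G) \<noteq> ((v (i + 1), v i) \<in> parcs G)) \<and>
     parcs G \<subseteq> (\<Union>i\<in>{1..<n}. {(v i, v (i + 1)), (v (i + 1), v i)})"

definition is_source :: "'a pair_pre_digraph \<Rightarrow> 'a \<Rightarrow> bool" where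
  "is_source G x \<longleftrightarrow> x \<in> pverts G \<and> in_arcs (with_proj G) x = {}"

definition is_sink :: "'a pair_pre_digraph \<Rightarrow> 'a \<Rightarrow> bool" where
  "is_sink G x \<longleftrightarrow> x \<in> pverts G \<and> out_arcs (with_proj G) x = {}"

text \<open>The \<open>i\<close>-th source or sink along the path (counted from \<open>0\<close>) is
  \<open>a\<^sub>i = v (source_sink_positions G v n ! i)\<close>.\<close>

definition source_sink_positions :: "'a pair_pre_digraph \<Rightarrow> (nat \<Rightarrow> 'a) \<Rightarrow> nat \<Rightarrow> nat list" where
  "source_sink_positions G v n =
     filter (\<lambda>j. is_source G (v j) \<or> is_sink G (v j)) [1..<n + 1]"

text \<open>For \<open>n \<ge> 2\<close> the two end vertices are sources or sinks, see
  \<open>source_sink_positions_ends\<close> below, so the subtraction does not truncate.\<close>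

definition num_internal :: "'a pair_pre_digraph \<Rightarrow> (nat \<Rightarrow> 'a) \<Rightarrow> nat \<Rightarrow> nat" where
  "num_internal G v n = length (source_sink_positions G v n) - 2"

definition segment :: "'a pair_pre_digraph \<Rightarrow> (nat \<Rightarrow> 'a) \<Rightarrow> nat \<Rightarrow> nat \<Rightarrow> ('a, 'a \<times> 'a) pre_digraph" where
  "segment G v n i =
     with_proj G \<restriction> (v ` {source_sink_positions G v n ! (i - 1) .. source_sink_positions G v n ! i})"

lemma type_A_end_source_sink:
  assumes "type_A G v n" "n \<ge> 2" "j \<in> {1, n}"
  shows "is_source G (v j) \<or> is_sink G (v j)"
proof -
  define m where "m = (if j = 1 then 2 else n - 1)"
  have inj: "inj_on v {1..n}"
    and sub: "parcs G \<subseteq> (\<Union>i\<in>{1..<n}. {(v i, v (i + 1)), (v (i + 1), v i)})"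
    and ex: "\<forall>i\<in>{1..<n}. ((v i, v (i + 1)) \<in> parcs G) \<noteq> ((v (i + 1), v i) \<in> parcs G)"
    using assms(1) unfolding type_A_def by blast+
  have V: "v j \<in> pverts G"
    using assms unfolding type_A_def by auto
  have eq: "v a = v b \<longleftrightarrow> a = b" if "a \<in> {1..n}" "b \<in> {1..n}" for a b
    using inj_on_eq_iff[OF inj that] .
  have arcs: "e = (v m, v j) \<or> e = (v j, v m)" if e: "e \<in> parcs G" "fst e = v j \<or> snd e = v j" for e
  proof -
    obtain i where i: "i \<in> {1..<n}" "e = (v i, v (i + 1)) \<or> e = (v (i + 1), v i)"
      using sub e(1) by blast
    have "v j = v i \<or> v j = v (i + 1)"
      using i(2) e(2) by (metis fst_conv snd_conv)
    then have "i = j \<or> i + 1 = j"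
      using i(1) assms(2,3) eq[of j i] eq[of j "i + 1"] by auto
    then have "i = j \<and> i + 1 = m \<or> i + 1 = j \<and> i = m"
      using i(1) assms(2,3) by (auto simp: m_def)
    then show ?thesis using i(2) by auto
  qed
  have "((v m, v j) \<in> parcs G) \<noteq> ((v j, v m) \<in> parcs G)"
  proof (cases "j = 1")
    case True
    then show ?thesis
      using bspec[OF ex, of 1] assms(2) by (simp add: m_def eq_commute numeral_2_eq_2)
  next
    case False
    then show ?thesis
      using bspec[OF ex, of "n - 1"] assms(2,3) by (simp add: m_def)
  qed
  then consider "(v m, v j) \<notin> parcs G" | "(v j, v m) \<notin> parcs G" by blast
  moreover have "v m \<noteq> v j"
  proof -
    have "m \<in> {1..n}" "j \<in> {1..n}" "m \<noteq> j"
      using assms(2,3) by (auto simp: m_def)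
    then show ?thesis using eq by simp
  qed
  ultimately show ?thesis
  proof cases
    case 1
    then have "in_arcs (with_proj G) (v j) = {}"
      using arcs \<open>v m \<noteq> v j\<close> by (force simp: in_arcs_def)
    then show ?thesis using V by (simp add: is_source_def)
  next
    case 2
    then have "out_arcs (with_proj G) (v j) = {}"
      using arcs \<open>v m \<noteq> v j\<close> by (force simp: out_arcs_def)
    then show ?thesis using V by (simp add: is_sink_def)
  qed
qed

lemma source_sink_positions_ends:
  assumes "type_A G v n" "n \<ge> 2"
  shows "length (source_sink_positions G v n) \<ge> 2"
    and "hd (source_sink_positions G v n) = 1"
    and "last (source_sink_positions G v n) = n"
proof -
  have "[1..<n + 1] = 1 # [2..<n] @ [n]"
    using assms(2) by (simp add: upt_conv_Cons numeral_2_eq_2)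
  then have "\<exists>ps. source_sink_positions G v n = 1 # ps @ [n]"
    using type_A_end_source_sink[OF assms, of 1] type_A_end_source_sink[OF assms, of n]
    by (simp add: source_sink_positions_def)
  then show "length (source_sink_positions G v n) \<ge> 2"
    and "hd (source_sink_positions G v n) = 1"
    and "last (source_sink_positions G v n) = n"
    by auto
qed


section \<open>The Hecke--Kiselman monoid\<close>

text \<open>The least congruence on the free monoid \<open>lists (pverts G)\<close> containing the defining relations.
  The graph is meant to be finite, without loops and without antiparallel arcs.\<close>

inductive hk_cong :: "'a pair_pre_digraph \<Rightarrow> 'a list \<Rightarrow> 'a list \<Rightarrow> bool" for G where
  hk_idem: "x \<in> pverts G \<Longrightarrow> hk_cong G [x, x] [x]"
| hk_comm: "\<lbrakk>x \<in> pverts G; y \<in> pverts G; (x, y) \<notin> parcs G; (y, x) \<notin> parcs G\<rbrakk>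
    \<Longrightarrow> hk_cong G [x, y] [y, x]"
| hk_arc1: "\<lbrakk>x \<in> pverts G; y \<in> pverts G; (x, y) \<in> parcs G\<rbrakk> \<Longrightarrow> hk_cong G [x, y, x] [x, y]"
| hk_arc2: "\<lbrakk>x \<in> pverts G; y \<in> pverts G; (x, y) \<in> parcs G\<rbrakk> \<Longrightarrow> hk_cong G [y, x, y] [x, y]"
| hk_refl: "w \<in> lists (pverts G) \<Longrightarrow> hk_cong G w w"
| hk_sym: "hk_cong G u w \<Longrightarrow> hk_cong G w u"
| hk_trans: "\<lbrakk>hk_cong G u w; hk_cong G w z\<rbrakk> \<Longrightarrow> hk_cong G u z"
| hk_mult: "\<lbrakk>hk_cong G u u'; hk_cong G w w'\<rbrakk> \<Longrightarrow> hk_cong G (u @ w) (u' @ w')"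

definition hk_rel :: "'a pair_pre_digraph \<Rightarrow> 'a list rel" where
  "hk_rel G = {(u, w). hk_cong G u w}"

definition HK :: "'a pair_pre_digraph \<Rightarrow> 'a list set monoid" where
  "HK G = \<lparr>carrier = lists (pverts G) // hk_rel G,
           mult = (\<lambda>A B. \<Union>u\<in>A. \<Union>w\<in>B. hk_rel G `` {u @ w}),
           one = hk_rel G `` {[]}\<rparr>"

definition content :: "'a list set \<Rightarrow> 'a set" where
  "content A = (\<Union>w\<in>A. set w)"

definition max_content :: "'a pair_pre_digraph \<Rightarrow> 'a list set set" where
  "max_content G = {A \<in> carrier (HK G). content A = pverts G}"

lemma hk_cong_lists: "hk_cong G u w \<Longrightarrow> u \<in> lists (pverts G) \<and> w \<in> lists (pverts G)"
  by (induction rule: hk_cong.induct) auto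

lemma equiv_hk_rel: "equiv (lists (pverts G)) (hk_rel G)"
proof (rule equivI)
  show "hk_rel G \<subseteq> lists (pverts G) \<times> lists (pverts G)"
    using hk_cong_lists by (fastforce simp: hk_rel_def)
  show "refl_on (lists (pverts G)) (hk_rel G)"
    by (rule refl_onI) (simp add: hk_rel_def hk_refl)
  show "sym (hk_rel G)"
    by (rule symI) (simp add: hk_rel_def hk_sym)
  show "trans (hk_rel G)"
    by (rule transI) (use hk_trans in \<open>fastforce simp: hk_rel_def\<close>)
qed

lemma hk_cong_set: "hk_cong G u w \<Longrightarrow> set u = set w"
  by (induction rule: hk_cong.induct) auto

lemma content_class:
  assumes "w \<in> lists (pverts G)"
  shows "content (hk_rel G `` {w}) = set w"
  using hk_refl[OF assms] by (auto simp: content_def hk_rel_def dest: hk_cong_set)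

lemma HK_mult_class:
  assumes "u \<in> lists (pverts G)" "w \<in> lists (pverts G)"
  shows "hk_rel G `` {u} \<otimes>\<^bsub>HK G\<^esub> hk_rel G `` {w} = hk_rel G `` {u @ w}"
proof -
  have "hk_rel G `` {u' @ w'} = hk_rel G `` {u @ w}"
    if "hk_cong G u u'" "hk_cong G w w'" for u' w'
    using equiv_class_eq[OF equiv_hk_rel, of "u @ w" "u' @ w'"] hk_mult[OF that]
    by (simp add: hk_rel_def)
  moreover have "hk_cong G u u" "hk_cong G w w"
    using assms by (auto intro: hk_refl)
  moreover have "hk_rel G `` {u} \<otimes>\<^bsub>HK G\<^esub> hk_rel G `` {w} =
      (\<Union>(u', w')\<in>{u'. hk_cong G u u'} \<times> {w'. hk_cong G w w'}. hk_rel G `` {u' @ w'})"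
    by (auto simp: HK_def hk_rel_def)
  ultimately show ?thesis
    by blast
qed

lemma monoid_HK: "monoid (HK G)"
proof -
  have c: "carrier (HK G) = (\<lambda>w. hk_rel G `` {w}) ` lists (pverts G)"
    by (auto simp: HK_def quotient_def)
  have o: "\<one>\<^bsub>HK G\<^esub> = hk_rel G `` {[]}" by (simp add: HK_def)
  have ex: "\<exists>u. u \<in> lists (pverts G) \<and> x = hk_rel G `` {u}" if "x \<in> carrier (HK G)" for x
    using that unfolding c image_iff Bex_def .
  show ?thesis
  proof (rule monoidI)
    fix x y assume "x \<in> carrier (HK G)" "y \<in> carrier (HK G)"
    then obtain u w where *: "u \<in> lists (pverts G)" "w \<in> lists (pverts G)"
      and xy: "x = hk_rel G `` {u}" "y = hk_rel G `` {w}"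
      using ex by metis
    have "u @ w \<in> lists (pverts G)" using * by (simp only: append_in_lists_conv)
    then show "x \<otimes>\<^bsub>HK G\<^esub> y \<in> carrier (HK G)"
      unfolding c xy HK_mult_class[OF *] by (rule imageI)
  next
    show "\<one>\<^bsub>HK G\<^esub> \<in> carrier (HK G)"
      unfolding c o by (rule imageI) simp
  next
    fix x y z assume "x \<in> carrier (HK G)" "y \<in> carrier (HK G)" "z \<in> carrier (HK G)"
    then obtain u w t where *: "u \<in> lists (pverts G)" "w \<in> lists (pverts G)" "t \<in> lists (pverts G)"
      and xyz: "x = hk_rel G `` {u}" "y = hk_rel G `` {w}" "z = hk_rel G `` {t}"
      using ex by metis
    have **: "u @ w \<in> lists (pverts G)" "w @ t \<in> lists (pverts G)"
      using * by (simp_all only: append_in_lists_conv)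
    show "x \<otimes>\<^bsub>HK G\<^esub> y \<otimes>\<^bsub>HK G\<^esub> z = x \<otimes>\<^bsub>HK G\<^esub> (y \<otimes>\<^bsub>HK G\<^esub> z)"
      unfolding xyz HK_mult_class[OF *(1,2)] HK_mult_class[OF *(2,3)]
        HK_mult_class[OF **(1) *(3)] HK_mult_class[OF *(1) **(2)] append_assoc ..
  next
    fix x assume "x \<in> carrier (HK G)"
    then obtain u where u: "u \<in> lists (pverts G)" "x = hk_rel G `` {u}"
      using ex by metis
    have n: "[] \<in> lists (pverts G)" by simp
    show "\<one>\<^bsub>HK G\<^esub> \<otimes>\<^bsub>HK G\<^esub> x = x"
      unfolding o u(2) HK_mult_class[OF n u(1)] append_Nil ..
    show "x \<otimes>\<^bsub>HK G\<^esub> \<one>\<^bsub>HK G\<^esub> = x"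
      unfolding o u(2) HK_mult_class[OF u(1) n] append_Nil2 ..
  qed
qed


section \<open>The numbers in the counting formulas\<close>

definition catalan :: "nat \<Rightarrow> nat" where
  "catalan m = ((2 * m) choose m) div (m + 1)"

lemma catalan_exact: "(m + 1) * catalan m = (2 * m) choose m"
proof -
  have "Suc m * ((2 * m) choose Suc m) = m * ((2 * m) choose m)"
    using trans[OF binomial_absorption[of m "2 * m"] binomial_absorb_comp[of "2 * m" m, symmetric]]
    by (simp del: mult_Suc)
  then have "Suc m dvd m * ((2 * m) choose m)"
    by (metis dvd_triv_left)
  then have "Suc m dvd (2 * m) choose m"
    using coprime_Suc_left_nat coprime_dvd_mult_right_iff by blast
  then show ?thesis
    by (simp add: catalan_def del: mult_Suc)
qed

definition hk_coeff :: "nat \<Rightarrow> (nat \<Rightarrow> nat) \<Rightarrow> nat set \<Rightarrow> nat \<Rightarrow> int" where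
  "hk_coeff k l Q i =
    (let C = (\<lambda>m. int (catalan m));
         \<delta> = (\<lambda>j. if j \<in> Q then 1 else 0 :: nat)
     in if i = 1 then
          (if \<delta> 1 = 0 then C (l 1) else C (l 1 + 1) - C (l 1))
        else if i = k + 1 then
          (if \<delta> k = 0 then C (l (k + 1)) else C (l (k + 1) + 1) - C (l (k + 1)))
        else
          (if \<delta> (i - 1) + \<delta> i = 0 then C (l i - 1)
           else if \<delta> (i - 1) + \<delta> i = 1 then C (l i) - C (l i - 1)
           else C (l i + 1) - 2 * C (l i) + C (l i - 1)))"

end

theory Submission
  imports Defs
begin

text \<open>
  Deleting letters induces homomorphisms between Hecke--Kiselman monoids, and a source or sink
  needs to occur only once in a word. Hence, cutting the path at a source or sink \<open>a\<close>, the
  elements of content \<open>S\<close> correspond to pairs of elements whose contents are the parts of \<open>S\<close> on the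
  two sides of \<open>a\<close>, where \<open>a\<close> belongs to both. Between two consecutive cuts the path is directed,
  and the monoid of a directed path acts faithfully on the monotone maps \<open>f\<close> with \<open>f i \<le> i\<close>; the
  content of an element is the set of points that its map strictly decreases. These maps are
  counted by Catalan numbers. Summing over all contents from left to right, remembering only
  whether the last cut belongs to the content, gives the remaining two formulas.
\<close>

section \<open>Cutting at a source or sink\<close>

text \<open>Only elements of a fixed content factor at a cut: the shared vertex occurs on both sides
  or on neither, so pairs that disagree there have to be excluded. This is why the total count is a
  sum over contents and takes the form of a product of 2 by 2 transfer matrices, one per directed
  piece. The set Q of the formula consists of the indices of those internal sources and sinks that
  occur in the content. A directed piece with l vertices has C_{l+1} elements in all. Prescribing
  whether its two ends occur is inclusion-exclusion over pieces shortened by one or both ends, hence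
  the entries C_{l-1}, C_l - C_{l-1} and C_{l+1} - 2 C_l + C_{l-1}. The first and last coefficients
  are sums of such entries over the unrecorded outer end. For pieces with two vertices the matrix
  has entries 1, 1, 1, 2 and advances the Fibonacci numbers by two. The delicate point of the
  factorisation is injectivity: two words with the same pair of deletions must be congruent. The
  single occurrence of the cut vertex fixes which letters stand before and after it, and apart from
  it letters of opposite sides commute.\<close>

lemma bij_betw_images_if_same_kernel:
  assumes "\<And>x y. x \<in> W \<Longrightarrow> y \<in> W \<Longrightarrow> f x = f y \<longleftrightarrow> g x = g y"
  shows "\<exists>h. bij_betw h (f ` W) (g ` W)"
proof -
  have *: "g (inv_into W f (f x)) = g x" if "x \<in> W" for x
    using assms[OF inv_into_into[OF imageI[OF that]] that] f_inv_into_f[OF imageI[OF that]] by metis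
  have "bij_betw (\<lambda>y. g (inv_into W f y)) (f ` W) (g ` W)"
    unfolding bij_betw_def
  proof
    show "inj_on (\<lambda>y. g (inv_into W f y)) (f ` W)"
      using * assms by (auto intro!: inj_onI)
    show "(\<lambda>y. g (inv_into W f y)) ` f ` W = g ` W"
      using * by (force simp: image_iff)
  qed
  then show ?thesis by blast
qed

definition hk_class :: "'a pair_pre_digraph \<Rightarrow> 'a list \<Rightarrow> 'a list set" where
  "hk_class G w = hk_rel G `` {w}"

text \<open>Written as an image of a set of words, not as a subset of the carrier, so that
  bijections arise by comparing kernels of maps on words.\<close>

definition content_classes :: "'a pair_pre_digraph \<Rightarrow> 'a set \<Rightarrow> 'a list set set" where
  "content_classes G S = hk_class G ` {w. set w = S}"

lemma hk_class_eq_iff: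
  assumes "u \<in> lists (pverts G)" "w \<in> lists (pverts G)"
  shows "hk_class G u = hk_class G w \<longleftrightarrow> hk_cong G u w"
  using eq_equiv_class_iff[OF equiv_hk_rel assms] by (simp add: hk_class_def hk_rel_def)

lemma carrier_HK: "carrier (HK G) = hk_class G ` lists (pverts G)"
  by (auto simp: HK_def quotient_def hk_class_def)

lemma content_hk_class: "w \<in> lists (pverts G) \<Longrightarrow> content (hk_class G w) = set w"
  by (simp add: hk_class_def content_class)

lemma max_content_eq: "max_content G = content_classes G (pverts G)"
proof -
  have "content A = pverts G \<longleftrightarrow> set w = pverts G" if "A = hk_class G w" "w \<in> lists (pverts G)" for A w
    using that content_hk_class by metis
  then show ?thesis
    unfolding max_content_def carrier_HK content_classes_def by blast
qed

lemma classes_lists_eq: "hk_class G ` lists S = (\<Union>T\<in>Pow S. content_classes G T)"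
  by (auto simp: content_classes_def)

lemma content_of_content_classes:
  "S \<subseteq> pverts G \<Longrightarrow> x \<in> content_classes G S \<Longrightarrow> content x = S"
  by (auto simp: content_classes_def content_hk_class subset_iff in_lists_conv_set)

lemma card_classes_lists:
  assumes "finite S" "S \<subseteq> pverts G" "\<And>T. T \<subseteq> S \<Longrightarrow> finite (content_classes G T)"
  shows "card (hk_class G ` lists S) = (\<Sum>T\<in>Pow S. card (content_classes G T))"
  unfolding classes_lists_eq
proof (rule card_UN_disjoint)
  show "\<forall>T\<in>Pow S. \<forall>T'\<in>Pow S. T \<noteq> T' \<longrightarrow> content_classes G T \<inter> content_classes G T' = {}"
  proof (intro ballI impI equals0I)
    fix T T' x
    assume T: "T \<in> Pow S" "T' \<in> Pow S" "T \<noteq> T'" and x: "x \<in> content_classes G T \<inter> content_classes G T'"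
    have "T \<subseteq> pverts G" "T' \<subseteq> pverts G" using T assms(2) by blast+
    with T(3) x show False using content_of_content_classes by (metis IntD1 IntD2)
  qed
qed (use assms in auto)

section \<open>Congruence calculus: contexts, deletion of letters, commutation\<close>

lemma hk_cong_context:
  assumes "hk_cong G u w" "x \<in> lists (pverts G)" "y \<in> lists (pverts G)"
  shows "hk_cong G (x @ u @ y) (x @ w @ y)"
  by (intro hk_mult hk_refl assms)

lemma hk_cong_appendL:
  "hk_cong G u w \<Longrightarrow> x \<in> lists (pverts G) \<Longrightarrow> hk_cong G (x @ u) (x @ w)"
  by (intro hk_mult hk_refl)

lemma hk_cong_appendR:
  "hk_cong G u w \<Longrightarrow> y \<in> lists (pverts G) \<Longrightarrow> hk_cong G (u @ y) (w @ y)"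
  by (intro hk_mult hk_refl)

lemma hk_cong_Cons:
  "hk_cong G u w \<Longrightarrow> x \<in> pverts G \<Longrightarrow> hk_cong G (x # u) (x # w)"
  using hk_cong_appendL[of G u w "[x]"] by simp

declare hk_trans [trans]

text \<open>Deletion respects every defining relation: what remains is the same relation, an
  idempotent relation (from \<open>[x, y, x]\<close> without \<open>y\<close>), or an equality of
  words.\<close>

lemma hk_cong_filter:
  assumes "hk_cong G u w"
  shows "hk_cong G (filter P u) (filter P w)"
  using assms
proof (induction rule: hk_cong.induct)
  case (hk_refl w)
  then have "filter P w \<in> lists (pverts G)" by auto
  then show ?case by (rule hk_cong.hk_refl)
next
  case (hk_sym u w)
  from hk_sym.IH show ?case by (rule hk_cong.hk_sym)
next
  case (hk_trans u w z)
  from hk_trans.IH show ?case by (rule hk_cong.hk_trans)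
next
  case (hk_mult u u' w w') then show ?case by (simp add: hk_cong.hk_mult)
qed (auto intro: hk_cong.intros)

lemma hk_cong_commute_letter:
  assumes "w \<in> lists (pverts G)" "x \<in> pverts G"
    "\<And>y. y \<in> set w \<Longrightarrow> (x, y) \<notin> parcs G \<and> (y, x) \<notin> parcs G"
  shows "hk_cong G (x # w) (w @ [x])"
  using assms
proof (induction w rule: list.induct)
  case Nil
  then show ?case by (simp add: hk_refl)
next
  case (Cons y w)
  then have "hk_cong G ([x, y] @ w) ([y, x] @ w)"
    by (intro hk_cong_appendR hk_comm) auto
  also have "hk_cong G ([y, x] @ w) (y # w @ [x])"
    using Cons by (auto intro!: hk_cong_Cons)
  finally show ?case by simp
qed

lemma hk_cong_commute:
  assumes "u \<in> lists (pverts G)" "w \<in> lists (pverts G)"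
    "\<And>x y. x \<in> set u \<Longrightarrow> y \<in> set w \<Longrightarrow> (x, y) \<notin> parcs G \<and> (y, x) \<notin> parcs G"
  shows "hk_cong G (u @ w) (w @ u)"
  using assms
proof (induction u rule: list.induct)
  case Nil
  then show ?case by (simp add: hk_refl)
next
  case (Cons x u)
  have IH: "hk_cong G (u @ w) (w @ u)" using Cons.prems by (intro Cons.IH) auto
  have "hk_cong G (x # u @ w) (x # w @ u)"
    using hk_cong_Cons[OF IH] Cons.prems by auto
  also have "hk_cong G (x # w @ u) (w @ x # u)"
    using hk_cong_appendR[OF hk_cong_commute_letter, of w G x u] Cons.prems by auto
  finally show ?case by simp
qed

lemma hk_cong_split:
  assumes "w \<in> lists (pverts G)" "set w \<subseteq> A \<union> B" "A \<inter> B = {}"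
    "\<And>x y. x \<in> A \<Longrightarrow> y \<in> B \<Longrightarrow> (x, y) \<notin> parcs G \<and> (y, x) \<notin> parcs G"
  shows "hk_cong G w (filter (\<lambda>x. x \<in> A) w @ filter (\<lambda>x. x \<in> B) w)"
  using assms(1,2)
proof (induction w rule: list.induct)
  case Nil
  then show ?case by (simp add: hk_refl)
next
  case (Cons x w)
  let ?A = "filter (\<lambda>x. x \<in> A) w" and ?B = "filter (\<lambda>x. x \<in> B) w"
  have x: "x \<in> pverts G" using Cons.prems by auto
  have "hk_cong G w (?A @ ?B)" using Cons.prems by (intro Cons.IH) auto
  from hk_cong_Cons[OF this x] have IH: "hk_cong G (x # w) (x # ?A @ ?B)" .
  show ?case
  proof (cases "x \<in> A")
    case True
    then show ?thesis using IH assms(3) by auto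
  next
    case False
    then have xB: "x \<in> B" using Cons.prems by auto
    have "hk_cong G ((x # ?A) @ ?B) ((?A @ [x]) @ ?B)"
      using Cons.prems assms(4) xB
      by (intro hk_cong_appendR hk_cong_commute_letter) auto
    with IH show ?thesis using False xB by (auto intro: hk_trans)
  qed
qed

section \<open>Absorption of repeated sources and sinks\<close>

lemma is_source_iff: "is_source G x \<longleftrightarrow> x \<in> pverts G \<and> (\<forall>y. (y, x) \<notin> parcs G)"
  by (auto simp: is_source_def in_arcs_def)

lemma is_sink_iff: "is_sink G x \<longleftrightarrow> x \<in> pverts G \<and> (\<forall>y. (x, y) \<notin> parcs G)"
  by (auto simp: is_sink_def out_arcs_def)

text \<open>At a sink \<open>a\<close>, the words \<open>[a, c, a]\<close> and \<open>[c, a]\<close>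
  are congruent for every letter \<open>c\<close>: by the relation of the arc from \<open>c\<close>
  to \<open>a\<close> if there is one, by commutation and idempotency otherwise. So an earlier
  \<open>a\<close> can travel right until it meets the last one.\<close>

lemma sink_absorb:
  assumes "is_sink G a" "w \<in> lists (pverts G)"
  shows "hk_cong G (a # w @ [a]) (w @ [a])"
  using assms(2)
proof (induction w rule: list.induct)
  case Nil
  then show ?case using assms by (auto simp: is_sink_iff intro: hk_idem)
next
  case (Cons c w)
  have a: "a \<in> pverts G" "(a, c) \<notin> parcs G" using assms(1) by (auto simp: is_sink_iff)
  have c: "c \<in> pverts G" "w \<in> lists (pverts G)" using Cons.prems by auto
  note IH = Cons.IH[OF c(2)]
  \<comment> \<open>The induction hypothesis, read backwards, creates an auxiliary \<open>a\<close>
    right after \<open>c\<close>. It serves to remove the leading \<open>a\<close> and is then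
    absorbed in turn.\<close>
  have "hk_cong G (a # c # w @ [a]) (a # c # a # w @ [a])"
    using hk_cong_appendL[OF hk_sym[OF IH], of "[a, c]"] a c by simp
  also have "hk_cong G (a # c # a # w @ [a]) (c # a # w @ [a])"
  proof -
    have "w @ [a] \<in> lists (pverts G)" using a c by simp
    moreover have "hk_cong G [a, c, a] [c, a]"
    proof (cases "(c, a) \<in> parcs G")
      case True
      then show ?thesis using a c by (intro hk_arc2)
    next
      case False
      then have "hk_cong G [a, c, a] [c, a, a]"
        using a c hk_cong_appendR[OF hk_comm, of a G c "[a]"] by simp
      also have "hk_cong G [c, a, a] [c, a]"
        using a c hk_cong_appendL[OF hk_idem, of a G "[c]"] by simp
      finally show ?thesis .
    qed
    ultimately show ?thesis
      using hk_cong_appendR[of G "[a, c, a]" "[c, a]" "w @ [a]"] by simp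
  qed
  also have "hk_cong G (c # a # w @ [a]) (c # w @ [a])"
    using hk_cong_Cons[OF IH c(1)] by simp
  finally show ?case by simp
qed

lemma source_absorb:
  assumes "is_source G a" "w \<in> lists (pverts G)"
  shows "hk_cong G (a # w @ [a]) (a # w)"
  using assms(2)
proof (induction w rule: rev_induct)
  case Nil
  then show ?case using assms by (auto simp: is_source_iff intro: hk_idem)
next
  case (snoc c w)
  have a: "a \<in> pverts G" "(c, a) \<notin> parcs G" using assms(1) by (auto simp: is_source_iff)
  have c: "c \<in> pverts G" "w \<in> lists (pverts G)" using snoc.prems by auto
  note IH = snoc.IH[OF c(2)]
  have "hk_cong G (a # w @ [c, a]) (a # w @ [a, c, a])"
    using hk_cong_appendR[OF hk_sym[OF IH], of "[c, a]"] a c by simp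
  also have "hk_cong G (a # w @ [a, c, a]) (a # w @ [a, c])"
  proof -
    have "a # w \<in> lists (pverts G)" using a c by simp
    moreover have "hk_cong G [a, c, a] [a, c]"
    proof (cases "(a, c) \<in> parcs G")
      case True
      then show ?thesis using a c by (intro hk_arc1)
    next
      case False
      then have "hk_cong G [a, c, a] [a, a, c]"
        using a c hk_cong_appendL[OF hk_comm, of c G a "[a]"] by simp
      also have "hk_cong G [a, a, c] [a, c]"
        using a c hk_cong_appendR[OF hk_idem, of a G "[c]"] by simp
      finally show ?thesis .
    qed
    ultimately show ?thesis
      using hk_cong_appendL[of G "[a, c, a]" "[a, c]" "a # w"] by simp
  qed
  also have "hk_cong G (a # w @ [a, c]) (a # w @ [c])"
    using c hk_cong_appendR[OF IH, of "[c]"] by simp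
  finally show ?case by simp
qed

text \<open>A sink keeps its last occurrence and a source its first; absorption removes all
  others.\<close>

lemma hk_cong_single_occurrence:
  assumes "is_source G a \<or> is_sink G a" "w \<in> lists (pverts G)" "a \<in> set w"
  shows "\<exists>x y. hk_cong G w (x @ a # y) \<and> a \<notin> set x \<and> a \<notin> set y"
  using assms(1)
proof
  assume a: "is_sink G a"
  then have aG: "a \<in> pverts G" by (simp add: is_sink_iff)
  obtain x y where w: "w = x @ a # y" "a \<notin> set y" using split_list_last[OF assms(3)] by blast
  have single: "hk_cong G (x @ [a]) (filter (\<lambda>b. b \<noteq> a) x @ [a])" if "x \<in> lists (pverts G)" for x
    using that
  proof (induction x rule: list.induct)
    case Nil
    then show ?case using aG by (simp add: hk_refl)
  next
    case (Cons b x)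
    then have b: "b \<in> pverts G" "x \<in> lists (pverts G)" by auto
    from hk_cong_Cons[OF Cons.IH[OF b(2)] b(1)]
    have "hk_cong G (b # x @ [a]) (b # filter (\<lambda>b. b \<noteq> a) x @ [a])" .
    moreover have "filter (\<lambda>b. b \<noteq> a) x \<in> lists (pverts G)" using Cons.prems by auto
    ultimately show ?case using sink_absorb[OF a] by (auto intro: hk_trans)
  qed
  have "x \<in> lists (pverts G)" "y \<in> lists (pverts G)" using assms(2) w by auto
  from hk_cong_appendR[OF single[OF this(1)] this(2)]
  have "hk_cong G w (filter (\<lambda>b. b \<noteq> a) x @ a # y)"
    using w by simp
  then show ?thesis using w(2) by (metis (mono_tags, lifting) mem_Collect_eq set_filter)
next
  assume a: "is_source G a"
  then have aG: "a \<in> pverts G" by (simp add: is_source_iff)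
  obtain x y where w: "w = x @ a # y" "a \<notin> set x" using split_list_first[OF assms(3)] by blast
  have single: "hk_cong G (a # y) (a # filter (\<lambda>b. b \<noteq> a) y)" if "y \<in> lists (pverts G)" for y
    using that
  proof (induction y rule: rev_induct)
    case Nil
    then show ?case using aG by (simp add: hk_refl)
  next
    case (snoc b y)
    then have b: "b \<in> pverts G" "y \<in> lists (pverts G)" by auto
    have "hk_cong G ((a # y) @ [b]) ((a # filter (\<lambda>b. b \<noteq> a) y) @ [b])"
      using hk_cong_appendR[OF snoc.IH[OF b(2)], of "[b]"] b(1) by simp
    moreover have "filter (\<lambda>b. b \<noteq> a) y \<in> lists (pverts G)" using snoc.prems by auto
    ultimately show ?case using source_absorb[OF a] by (auto intro: hk_trans)
  qed
  have "x \<in> lists (pverts G)" "y \<in> lists (pverts G)" using assms(2) w by auto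
  from hk_cong_appendL[OF single[OF this(2)] this(1)]
  have "hk_cong G w (x @ a # filter (\<lambda>b. b \<noteq> a) y)"
    using w by simp
  then show ?thesis using w(2) by (metis (mono_tags, lifting) mem_Collect_eq set_filter)
qed

text \<open>Common frame for the two ways in which a content can split: the map sends a word to its
  two deletions. That it is well defined on classes holds in general, so each case has to supply
  only injectivity and a word merging two given ones.\<close>

lemma content_classes_product_if_kernel:
  assumes "S \<subseteq> pverts G" "S = A \<union> B"
    and inj: "\<And>w w'. set w = S \<Longrightarrow> set w' = S \<Longrightarrow>
      hk_cong G (filter (\<lambda>x. x \<in> A) w) (filter (\<lambda>x. x \<in> A) w') \<Longrightarrow>
      hk_cong G (filter (\<lambda>x. x \<in> B) w) (filter (\<lambda>x. x \<in> B) w') \<Longrightarrow> hk_cong G w w'"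
    and surj: "\<And>u w. set u = A \<Longrightarrow> set w = B \<Longrightarrow>
      \<exists>z. set z = S \<and> hk_cong G u (filter (\<lambda>x. x \<in> A) z) \<and> hk_cong G w (filter (\<lambda>x. x \<in> B) z)"
  shows "\<exists>h. bij_betw h (content_classes G S) (content_classes G A \<times> content_classes G B)"
proof -
  define p where "p w = (hk_class G (filter (\<lambda>x. x \<in> A) w), hk_class G (filter (\<lambda>x. x \<in> B) w))" for w
  have eq: "hk_class G u = hk_class G w \<longleftrightarrow> hk_cong G u w" if "set u \<subseteq> S" "set w \<subseteq> S" for u w
    using that assms(1) by (intro hk_class_eq_iff) (auto simp: in_lists_conv_set)
  have "\<exists>h. bij_betw h (hk_class G ` {w. set w = S}) (p ` {w. set w = S})"
  proof (rule bij_betw_images_if_same_kernel)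
    fix w w' assume w: "w \<in> {w. set w = S}" "w' \<in> {w. set w = S}"
    have "p w = p w' \<longleftrightarrow> hk_cong G (filter (\<lambda>x. x \<in> A) w) (filter (\<lambda>x. x \<in> A) w') \<and>
      hk_cong G (filter (\<lambda>x. x \<in> B) w) (filter (\<lambda>x. x \<in> B) w')"
      using w assms(2) eq[of "filter (\<lambda>x. x \<in> A) w" "filter (\<lambda>x. x \<in> A) w'"]
        eq[of "filter (\<lambda>x. x \<in> B) w" "filter (\<lambda>x. x \<in> B) w'"]
      by (simp add: p_def) blast
    also have "\<dots> \<longleftrightarrow> hk_cong G w w'"
      using w inj by (auto intro: hk_cong_filter)
    finally show "hk_class G w = hk_class G w' \<longleftrightarrow> p w = p w'"
      using w by (simp add: eq)
  qed
  moreover have "p ` {w. set w = S} = content_classes G A \<times> content_classes G B"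
  proof
    show "p ` {w. set w = S} \<subseteq> content_classes G A \<times> content_classes G B"
      using assms(2) by (auto simp: p_def content_classes_def intro!: imageI)
    show "content_classes G A \<times> content_classes G B \<subseteq> p ` {w. set w = S}"
    proof
      fix c assume "c \<in> content_classes G A \<times> content_classes G B"
      then obtain u w where c: "c = (hk_class G u, hk_class G w)" and uw: "set u = A" "set w = B"
        by (auto simp: content_classes_def)
      from surj[OF uw] obtain z where z: "set z = S" "hk_cong G u (filter (\<lambda>x. x \<in> A) z)"
        "hk_cong G w (filter (\<lambda>x. x \<in> B) z)" by blast
      then have "c = p z"
        using uw c assms(2) eq[of u "filter (\<lambda>x. x \<in> A) z"] eq[of w "filter (\<lambda>x. x \<in> B) z"]
        by (auto simp: p_def)
      then show "c \<in> p ` {w. set w = S}" using z by blast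
    qed
  qed
  ultimately show ?thesis by (simp add: content_classes_def)
qed

text \<open>Covers contents that do not contain the cut vertex: the letters of the two sides are
  then pairwise non-adjacent, and concatenation merges the two words.\<close>

lemma content_classes_disjoint:
  assumes "A \<union> B \<subseteq> pverts G" "A \<inter> B = {}"
    "\<And>x y. x \<in> A \<Longrightarrow> y \<in> B \<Longrightarrow> (x, y) \<notin> parcs G \<and> (y, x) \<notin> parcs G"
  shows "\<exists>h. bij_betw h (content_classes G (A \<union> B)) (content_classes G A \<times> content_classes G B)"
proof (rule content_classes_product_if_kernel[OF assms(1) refl])
  fix w w' assume w: "set w = A \<union> B" "set w' = A \<union> B"
    and h: "hk_cong G (filter (\<lambda>x. x \<in> A) w) (filter (\<lambda>x. x \<in> A) w')"
      "hk_cong G (filter (\<lambda>x. x \<in> B) w) (filter (\<lambda>x. x \<in> B) w')"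
  have "hk_cong G z (filter (\<lambda>x. x \<in> A) z @ filter (\<lambda>x. x \<in> B) z)" if "set z = A \<union> B" for z
    using that assms by (intro hk_cong_split) (auto simp: in_lists_conv_set)
  with w h show "hk_cong G w w'" by (meson hk_mult hk_sym hk_trans)
next
  fix u w assume uw: "set u = A" "set w = B"
  have "filter (\<lambda>x. x \<in> A) (u @ w) = u" "filter (\<lambda>x. x \<in> B) (u @ w) = w"
    using uw assms(2) by (auto simp: filter_id_conv filter_empty_conv)
  moreover have "hk_cong G u u" "hk_cong G w w"
    using uw assms(1) by (auto intro!: hk_refl simp: in_lists_conv_set)
  ultimately show "\<exists>z. set z = A \<union> B \<and> hk_cong G u (filter (\<lambda>x. x \<in> A) z) \<and>
      hk_cong G w (filter (\<lambda>x. x \<in> B) z)"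
    using uw by (metis set_append)
qed

text \<open>A source or sink \<open>a\<close> needs to occur only once in a word; the letters before it, and the letters
  after it, can then be sorted into those of \<open>A\<close> and those of \<open>B\<close>, with either ones outermost.\<close>

lemma content_classes_cut:
  assumes sub: "A \<union> B \<subseteq> pverts G" and int: "A \<inter> B = {a}" and a: "is_source G a \<or> is_sink G a"
    and no: "\<And>x y. x \<in> A - {a} \<Longrightarrow> y \<in> B - {a} \<Longrightarrow> (x, y) \<notin> parcs G \<and> (y, x) \<notin> parcs G"
  shows "\<exists>h. bij_betw h (content_classes G (A \<union> B)) (content_classes G A \<times> content_classes G B)"
proof (rule content_classes_product_if_kernel[OF sub refl])
  let ?A = "filter (\<lambda>x. x \<in> A)" and ?B = "filter (\<lambda>x. x \<in> B)"
  have nf: "\<exists>x y. a \<notin> set x \<and> a \<notin> set y \<and> hk_cong G w (?B x @ ?A (x @ a # y) @ ?B y) \<and>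
      hk_cong G w (?A x @ ?B (x @ a # y) @ ?A y) \<and> hk_cong G (?A w) (?A (x @ a # y)) \<and>
      hk_cong G (?B w) (?B (x @ a # y))" if w: "set w = A \<union> B" for w
  proof -
    have wl: "w \<in> lists (pverts G)" "a \<in> set w" using w sub int by auto
    obtain x y where xy: "hk_cong G w (x @ a # y)" "a \<notin> set x" "a \<notin> set y"
      using hk_cong_single_occurrence[OF a wl] by blast
    have s: "set (x @ a # y) = A \<union> B" using hk_cong_set[OF xy(1)] w by simp
    have aA: "a \<in> A" "a \<in> B" using int by auto
    have l: "x \<in> lists (pverts G)" "y \<in> lists (pverts G)" "a \<in> pverts G" using s sub by auto
    have fl: "filter P x \<in> lists (pverts G)" "filter P y \<in> lists (pverts G)" for P
      using l by auto
    have AB: "hk_cong G z (?A z @ ?B z)" "hk_cong G z (?B z @ ?A z)" if z: "z = x \<or> z = y" for z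
    proof -
      have zl: "z \<in> lists (pverts G)" "set z \<subseteq> (A - {a}) \<union> (B - {a})" "set z \<subseteq> (B - {a}) \<union> (A - {a})"
        using z l s xy by auto
      have fe: "filter (\<lambda>x. x \<in> A - {a}) z = ?A z" "filter (\<lambda>x. x \<in> B - {a}) z = ?B z"
        using z xy by (auto intro!: filter_cong)
      have d: "(A - {a}) \<inter> (B - {a}) = {}" "(B - {a}) \<inter> (A - {a}) = {}" using int by auto
      show "hk_cong G z (?A z @ ?B z)"
        using hk_cong_split[OF zl(1,2) d(1)] no fe by simp
      show "hk_cong G z (?B z @ ?A z)"
        using hk_cong_split[OF zl(1,3) d(2)] no fe by simp
    qed
    have "hk_cong G (x @ [a] @ y) ((?B x @ ?A x) @ [a] @ (?A y @ ?B y))"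
      by (intro hk_mult AB hk_refl) (use l in auto)
    moreover have "hk_cong G (x @ [a] @ y) ((?A x @ ?B x) @ [a] @ (?B y @ ?A y))"
      by (intro hk_mult AB hk_refl) (use l in auto)
    ultimately have "hk_cong G w (?B x @ ?A (x @ a # y) @ ?B y)"
      "hk_cong G w (?A x @ ?B (x @ a # y) @ ?A y)"
      using hk_trans[OF xy(1)] aA by auto
    then show ?thesis using xy hk_cong_filter[OF xy(1)] by blast
  qed
  {
    fix w w' assume w: "set w = A \<union> B" "set w' = A \<union> B"
      and h: "hk_cong G (?A w) (?A w')" "hk_cong G (?B w) (?B w')"
    obtain x y where sx: "a \<notin> set x" "a \<notin> set y" and 1: "hk_cong G w (?B x @ ?A (x @ a # y) @ ?B y)"
      "hk_cong G (?A w) (?A (x @ a # y))" "hk_cong G (?B w) (?B (x @ a # y))"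
      using nf[OF w(1)] by blast
    obtain x' y' where sx': "a \<notin> set x'" "a \<notin> set y'" and 2: "hk_cong G w' (?A x' @ ?B (x' @ a # y') @ ?A y')"
      "hk_cong G (?A w') (?A (x' @ a # y'))" "hk_cong G (?B w') (?B (x' @ a # y'))"
      using nf[OF w(2)] by blast
    have eqA: "hk_cong G (?A (x @ a # y)) (?A (x' @ a # y'))"
      and eqB: "hk_cong G (?B (x @ a # y)) (?B (x' @ a # y'))"
      using 1 2 h by (meson hk_sym hk_trans)+
    have l: "?B x \<in> lists (pverts G)" "?B y \<in> lists (pverts G)"
       "?A x' \<in> lists (pverts G)" "?A y' \<in> lists (pverts G)"
      using sub by auto
    have aA: "a \<in> A" "a \<in> B" using int by auto
    \<comment> \<open>The outer letters of the two normal forms lie on opposite sides and avoid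
      \<open>a\<close>, so they commute.\<close>
    have cx: "hk_cong G (?B x @ ?A x') (?A x' @ ?B x)"
      and cy: "hk_cong G (?A y' @ ?B y) (?B y @ ?A y')"
      using l sx sx' by (auto intro!: hk_cong_commute dest: no[OF DiffI DiffI])
    \<comment> \<open>The \<open>A\<close>-part of \<open>w\<close> in the middle is replaced by
      that of \<open>w'\<close>; commuting the outer letters inwards regroups the word around the
      \<open>B\<close>-part of \<open>w\<close>, which is then replaced by that of
      \<open>w'\<close>.\<close>
    note 1(1)
    also have "hk_cong G (?B x @ ?A (x @ a # y) @ ?B y) (?B x @ ?A (x' @ a # y') @ ?B y)"
      by (intro hk_cong_context eqA l)
    also have "hk_cong G (?B x @ ?A (x' @ a # y') @ ?B y) (?A x' @ ?B (x @ a # y) @ ?A y')"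
      using hk_mult[OF cx hk_mult[OF hk_refl[of "[a]"] cy]] aA sub by auto
    also have "hk_cong G (?A x' @ ?B (x @ a # y) @ ?A y') (?A x' @ ?B (x' @ a # y') @ ?A y')"
      by (intro hk_cong_context eqB l)
    also note hk_sym[OF 2(1)]
    finally show "hk_cong G w w'" .
  }
  {
    fix u w assume uw: "set u = A" "set w = B"
    have aA: "a \<in> A" "a \<in> B" using int by auto
    have ul: "u \<in> lists (pverts G)" "w \<in> lists (pverts G)" using uw sub by auto
    obtain x1 y1 where 1: "hk_cong G u (x1 @ a # y1)" "a \<notin> set x1" "a \<notin> set y1"
      using hk_cong_single_occurrence[OF a ul(1)] uw aA by auto
    obtain x2 y2 where 2: "hk_cong G w (x2 @ a # y2)" "a \<notin> set x2" "a \<notin> set y2"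
      using hk_cong_single_occurrence[OF a ul(2)] uw aA by auto
    have s: "set (x1 @ a # y1) = A" "set (x2 @ a # y2) = B"
      using hk_cong_set[OF 1(1)] hk_cong_set[OF 2(1)] uw by auto
    have "?A x2 = []" "?A y2 = []" "?B x1 = []" "?B y1 = []" "?A x1 = x1" "?A y1 = y1"
      "?B x2 = x2" "?B y2 = y2"
      using s 1 2 int by (auto simp: filter_empty_conv filter_id_conv)
    \<comment> \<open>The two words are glued along their only \<open>a\<close>.\<close>
    then have "set (x1 @ x2 @ a # y1 @ y2) = A \<union> B" "?A (x1 @ x2 @ a # y1 @ y2) = x1 @ a # y1"
      "?B (x1 @ x2 @ a # y1 @ y2) = x2 @ a # y2"
      using aA s by auto
    then show "\<exists>z. set z = A \<union> B \<and> hk_cong G u (?A z) \<and> hk_cong G w (?B z)"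
      using 1 2 by metis
  }
qed


section \<open>Ballot maps\<close>

text \<open>Extended by the identity beyond \<open>L\<close>, so that equality of maps is plain
  equality of functions. The point 0 corresponds to no vertex; it is there for the first vertex to
  copy from.\<close>

definition ballot_maps :: "nat \<Rightarrow> (nat \<Rightarrow> nat) set" where
  "ballot_maps L = {f. mono f \<and> (\<forall>i. f i \<le> i) \<and> (\<forall>i>L. f i = i)}"

lemma ballot_maps_0: "ballot_maps 0 = {id}"
proof -
  have "f i = i" if "f \<in> ballot_maps 0" for f i
    using that by (cases i) (auto simp: ballot_maps_def)
  then show ?thesis by (auto simp: ballot_maps_def mono_def)
qed

lemma finite_ballot_maps: "finite (ballot_maps L)"
proof -
  have "ballot_maps L \<subseteq> (\<lambda>g i. if i \<le> L then g i else i) ` ({..L} \<rightarrow>\<^sub>E {..L})"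
  proof
    fix f assume f: "f \<in> ballot_maps L"
    have mem: "restrict f {..L} \<in> {..L} \<rightarrow>\<^sub>E {..L}"
    proof (rule restrict_PiE_iff[THEN iffD2], intro ballI)
      fix i assume "i \<in> {..L}"
      moreover have "f i \<le> i" using f by (simp add: ballot_maps_def)
      ultimately show "f i \<in> {..L}" by simp
    qed
    have eq: "(\<lambda>i. if i \<le> L then restrict f {..L} i else i) = f"
      using f by (auto simp: ballot_maps_def fun_eq_iff)
    show "f \<in> (\<lambda>g i. if i \<le> L then g i else i) ` ({..L} \<rightarrow>\<^sub>E {..L})"
      using image_eqI[where f = "\<lambda>g i. if i \<le> L then g i else i", OF eq[symmetric] mem] .
  qed
  then show ?thesis by (rule finite_subset) (simp add: finite_PiE)
qed

section \<open>Ballot numbers: counting by the value at the last point\<close>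

lemma card_ballot_maps_last:
  assumes "j \<le> Suc L"
  shows "card {f \<in> ballot_maps (Suc L). f (Suc L) = j} = card {f \<in> ballot_maps L. f L \<le> j}"
proof (rule bij_betw_same_card[of "\<lambda>f. f(Suc L := Suc L)"], rule bij_betw_byWitness[where f' = "\<lambda>f. f(Suc L := j)"])
  show "\<forall>f\<in>{f \<in> ballot_maps (Suc L). f (Suc L) = j}. (f(Suc L := Suc L))(Suc L := j) = f"
    by auto
  show "\<forall>f\<in>{f \<in> ballot_maps L. f L \<le> j}. (f(Suc L := j))(Suc L := Suc L) = f"
    by (auto simp: ballot_maps_def fun_eq_iff)
  show "(\<lambda>f. f(Suc L := Suc L)) ` {f \<in> ballot_maps (Suc L). f (Suc L) = j} \<subseteq> {f \<in> ballot_maps L. f L \<le> j}"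
  proof clarsimp
    fix f assume f: "f \<in> ballot_maps (Suc L)" "j = f (Suc L)"
    show "f(Suc L := Suc L) \<in> ballot_maps L \<and> f L \<le> f (Suc L)"
      using f unfolding ballot_maps_def mono_def
      by (auto simp: not_le) (metis le_SucE le_Suc_eq le_trans not_less_eq_eq)
  qed
  show "(\<lambda>f. f(Suc L := j)) ` {f \<in> ballot_maps L. f L \<le> j} \<subseteq> {f \<in> ballot_maps (Suc L). f (Suc L) = j}"
  proof clarsimp
    fix f assume f: "f \<in> ballot_maps L" "f L \<le> j"
    have "f x \<le> j" if "x \<le> Suc L" "x \<noteq> Suc L" for x
      using f that le_trans[of "f x" "f L" j] by (auto simp: ballot_maps_def mono_def)
    moreover have "j \<le> f y" if "Suc L \<le> y" "y \<noteq> Suc L" for y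
      using f that assms by (auto simp: ballot_maps_def)
    ultimately show "f(Suc L := j) \<in> ballot_maps (Suc L)"
      using f assms unfolding ballot_maps_def mono_def by auto
  qed
qed

lemma card_ballot_maps_bounded_Suc:
  "card {f \<in> ballot_maps L. f L \<le> Suc j} =
   card {f \<in> ballot_maps L. f L \<le> j} + card {f \<in> ballot_maps L. f L = Suc j}"
proof -
  have "{f \<in> ballot_maps L. f L \<le> Suc j} =
    {f \<in> ballot_maps L. f L \<le> j} \<union> {f \<in> ballot_maps L. f L = Suc j}" by auto
  then show ?thesis
    using finite_ballot_maps by (simp add: card_Un_disjoint disjoint_iff)
qed

lemma card_ballot_maps_bounded_0: "card {f \<in> ballot_maps L. f L \<le> 0} = 1"
proof (induction L)
  case 0
  have "{f \<in> ballot_maps 0. f 0 \<le> 0} = {id}" by (auto simp: ballot_maps_0)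
  then show ?case by simp
next
  case (Suc L)
  then show ?case using card_ballot_maps_last[of 0 L] by simp
qed

text \<open>The ballot numbers in reflection form, with the subtraction moved to the other side to
  stay in the natural numbers. Splitting off the maps with the largest allowed value and removing
  their last point gives a recursion in \<open>L\<close> and \<open>j\<close> that Pascal's rule
  matches. The bound is \<open>Suc j\<close> so that \<open>j = L\<close> gives all maps.\<close>

lemma ballot_number:
  "j \<le> L \<Longrightarrow> card {f \<in> ballot_maps L. f L \<le> Suc j} + ((L + 2 + j) choose j) = (L + 2 + j) choose Suc j"
proof (induction L arbitrary: j)
  case 0
  have "{f \<in> ballot_maps 0. f 0 \<le> Suc 0} = {id}" by (auto simp: ballot_maps_0)
  then show ?case using 0 by simp
next
  case (Suc L)
  note outer = Suc.IH
  from Suc.prems show ?case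
  proof (induction j)
    case 0
    show ?case
      using card_ballot_maps_bounded_Suc[of "Suc L" 0] card_ballot_maps_bounded_0[of "Suc L"]
        card_ballot_maps_last[of 1 L] outer[of 0] by simp
  next
    case (Suc j)
    define N where "N = L + 3 + j"
    have N: "L + 2 + Suc j = N" "Suc L + 2 + j = N" "Suc L + 2 + Suc j = Suc N"
      by (simp_all add: N_def)
    have *: "card {f \<in> ballot_maps (Suc L). f (Suc L) \<le> Suc j} + (N choose j) = N choose Suc j"
      using Suc N by (simp del: binomial_Suc_Suc)
    have "card {f \<in> ballot_maps (Suc L). f (Suc L) = Suc (Suc j)} + (N choose Suc j) = N choose Suc (Suc j)"
    \<comment> \<open>On the boundary the value exceeds its position, so there is no such map;
      correspondingly \<open>N = 2 * L + 3\<close> and the two binomials are the equal middle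
      ones.\<close>
    proof (cases "j = L")
      case True
      have "f (Suc L) \<noteq> Suc (Suc L)" if "f \<in> ballot_maps (Suc L)" for f
      proof -
        have "f (Suc L) \<le> Suc L" using that by (simp add: ballot_maps_def)
        then show ?thesis by simp
      qed
      then have "{f \<in> ballot_maps (Suc L). f (Suc L) = Suc (Suc L)} = {}" by auto
      moreover have "N choose Suc j = N choose Suc (Suc j)"
        using binomial_symmetric[of "Suc j" N] True by (simp add: N_def del: binomial_Suc_Suc)
      ultimately show ?thesis using True by (simp only: card.empty add_0)
    next
      case False
      then have "Suc j \<le> L" using Suc.prems by simp
      with outer[of "Suc j"] N card_ballot_maps_last[of "Suc (Suc j)" L]
      show ?thesis by (simp del: binomial_Suc_Suc)
    qed
    with * card_ballot_maps_bounded_Suc[of "Suc L" "Suc j"] binomial_Suc_Suc[of N j]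
      binomial_Suc_Suc[of N "Suc j"]
    show ?case unfolding N by linarith
  qed
qed

text \<open>For \<open>j = L\<close> the ballot number is a difference of neighbouring binomials;
  the absorption identities turn it into the quotient form of the Catalan number.\<close>

lemma card_ballot_maps: "card (ballot_maps L) = catalan (Suc L)"
proof -
  have "f L \<le> Suc L" if "f \<in> ballot_maps L" for f
    using that by (auto simp: ballot_maps_def intro: le_SucI)
  then have "{f \<in> ballot_maps L. f L \<le> Suc L} = ballot_maps L" by auto
  then have *: "card (ballot_maps L) + ((2 * Suc L) choose L) = (2 * Suc L) choose Suc L"
    using ballot_number[of L L] by (simp add: mult_2)
  have "Suc L * ((2 * Suc L) choose Suc L) = (L + 2) * ((2 * Suc L) choose L)"
    using binomial_absorption[of L "2 * Suc L"] binomial_absorb_comp[of "2 * Suc L" L]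
    by (simp del: binomial_Suc_Suc)
  moreover have "(L + 2) * card (ballot_maps L) + (L + 2) * ((2 * Suc L) choose L) = (L + 2) * ((2 * Suc L) choose Suc L)"
    by (simp only: * flip: distrib_left)
  moreover have "(L + 2) * x = Suc L * x + x" for x :: nat by simp
  ultimately have "(L + 2) * card (ballot_maps L) = (2 * Suc L) choose Suc L"
    by (metis add.commute add_left_cancel)
  also have "\<dots> = (L + 2) * catalan (Suc L)"
    using catalan_exact[of "Suc L"] by simp
  finally show ?thesis by (simp del: mult_Suc)
qed

text \<open>Strictness at \<open>Suc i\<close> means \<open>f (Suc i) \<le> i\<close>, so forgetting
  the point 0 and shifting the arguments down by one leaves an arbitrary ballot map of one size
  less.\<close>

lemma card_ballot_maps_strict:
  "card {f \<in> ballot_maps (Suc L). \<forall>i\<in>{1..Suc L}. f i < i} = catalan (Suc L)"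
proof -
  let ?S = "{f \<in> ballot_maps (Suc L). \<forall>i\<in>{1..Suc L}. f i < i}"
  let ?d = "\<lambda>f i. if i \<le> L then f (Suc i) else (i::nat)"
  let ?u = "\<lambda>g i. if i = 0 \<or> Suc L < i then i else g (i - 1)"
  have "bij_betw ?d ?S (ballot_maps L)"
  proof (rule bij_betw_byWitness[where f' = ?u])
    have "f 0 = 0" if "f \<in> ballot_maps M" for f M
      using that by (simp add: ballot_maps_def) (metis le_zero_eq)
    then show "\<forall>f\<in>?S. ?u (?d f) = f"
      by (auto simp: ballot_maps_def fun_eq_iff)
    show "\<forall>g\<in>ballot_maps L. ?d (?u g) = g"
      by (auto simp: ballot_maps_def fun_eq_iff)
    show "?d ` ?S \<subseteq> ballot_maps L"
    proof clarify
      fix f assume f: "f \<in> ballot_maps (Suc L)" "\<forall>i\<in>{1..Suc L}. f i < i"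
      then have le: "f (Suc i) \<le> i" if "i \<le> L" for i
        using that by (auto simp: less_Suc_eq_le dest: bspec[of _ _ "Suc i"])
      show "?d f \<in> ballot_maps L"
        using f(1) le unfolding ballot_maps_def mono_def
        by (auto simp: not_le intro: order.trans[OF le])
    qed
    show "?u ` ballot_maps L \<subseteq> ?S"
    proof clarify
      fix g assume g: "g \<in> ballot_maps L"
      then have le: "g (i - 1) < i" if "i \<noteq> 0" for i
        using that by (auto simp: ballot_maps_def intro: le_less_trans[of _ "i - 1"])
      then have le': "g (i - 1) \<le> i" for i
        using g less_imp_le[OF le] by (cases "i = 0") (auto simp: ballot_maps_def intro: le_trans)
      have "mono (?u g)"
      proof (rule monoI)
        fix x y :: nat assume "x \<le> y"
        consider "Suc L < x" | "x = 0" | "0 < x" "y \<le> Suc L" | "0 < x" "x \<le> Suc L" "Suc L < y" by linarith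
        then show "?u g x \<le> ?u g y"
        proof cases
          case 3
          then show ?thesis using g \<open>x \<le> y\<close> by (auto simp: ballot_maps_def mono_def)
        next
          case 4
          then show ?thesis using le'[of x] by auto
        qed (use \<open>x \<le> y\<close> in auto)
      qed
      then show "?u g \<in> ballot_maps (Suc L) \<and> (\<forall>i\<in>{1..Suc L}. ?u g i < i)"
        using le le' by (auto simp: ballot_maps_def)
    qed
  qed
  from bij_betw_same_card[OF this] show ?thesis by (simp only: card_ballot_maps)
qed


section \<open>Directed paths\<close>

text \<open>The action of the \<open>i\<close>-th vertex of a directed path.\<close>

definition copy_left :: "(nat \<Rightarrow> nat) \<Rightarrow> nat \<Rightarrow> nat \<Rightarrow> nat" where
  "copy_left f i = f(i := f (i - 1))"

text \<open>The run \<open>f i + 1, \<dots>, i\<close> carries the value \<open>f i\<close> to position \<open>i\<close>. Large \<open>i\<close> are served first,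
  since the smaller positions are then still untouched.\<close>

primrec canonical_word :: "(nat \<Rightarrow> nat) \<Rightarrow> nat \<Rightarrow> nat list" where
  "canonical_word f 0 = []"
| "canonical_word f (Suc m) = [Suc (f (Suc m))..<Suc (Suc m)] @ canonical_word f m"

lemma canonical_word_cong:
  "(\<And>i. i \<le> m \<Longrightarrow> f i = g i) \<Longrightarrow> canonical_word f m = canonical_word g m"
  by (induction m) auto

lemma set_canonical_word: "set (canonical_word f m) \<subseteq> {1..m}"
  by (induction m) (auto simp del: upt_Suc)

lemma copy_left_ballot_maps:
  assumes "f \<in> ballot_maps L" "i \<in> {1..L}"
  shows "copy_left f i \<in> ballot_maps L"
proof -
  have f: "f x \<le> f y" if "x \<le> y" for x y using assms(1) that by (auto simp: ballot_maps_def mono_def)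
  have fi: "f x \<le> x" for x using assms(1) by (auto simp: ballot_maps_def)
  have "f (i - 1) \<le> i" using fi[of "i - 1"] by simp
  moreover have "mono (copy_left f i)"
    unfolding mono_def copy_left_def using f by auto
  ultimately show ?thesis
    using assms by (auto simp: ballot_maps_def copy_left_def)
qed

lemma id_ballot_maps: "id \<in> ballot_maps L"
  by (simp add: ballot_maps_def mono_def)

lemma foldl_copy_left_ballot_maps:
  "f \<in> ballot_maps L \<Longrightarrow> set w \<subseteq> {1..L} \<Longrightarrow> foldl copy_left f w \<in> ballot_maps L"
  by (induction w arbitrary: f) (simp_all add: copy_left_ballot_maps)

text \<open>Applying \<open>i\<close> changes only position \<open>i\<close>, whose new value is at
  most \<open>i - 1\<close>. Hence a decrease is never undone, and the content of a word can be read
  off its map.\<close>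

lemma foldl_copy_left_less_iff:
  "f \<in> ballot_maps L \<Longrightarrow> set w \<subseteq> {1..L} \<Longrightarrow> foldl copy_left f w j < j \<longleftrightarrow> f j < j \<or> j \<in> set w"
proof (induction w arbitrary: f)
  case (Cons i w)
  have "f (i - 1) \<le> i - 1" using Cons.prems by (auto simp: ballot_maps_def)
  then have "f (i - 1) < i" using Cons.prems by auto
  then show ?case
    using Cons.IH[OF copy_left_ballot_maps[of f L i]] Cons.prems by (auto simp: copy_left_def)
qed simp

lemma foldl_copy_left_upt:
  "p \<le> i \<Longrightarrow> foldl copy_left g [Suc p..<Suc i] j = (if p \<le> j \<and> j \<le> i then g p else g j)"
proof (induction i arbitrary: j)
  case (Suc i)
  show ?case
  proof (cases "p = Suc i")
    case False
    with Suc have "p \<le> i" by simp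
    then have "[Suc p..<Suc (Suc i)] = [Suc p..<Suc i] @ [Suc i]" by simp
    then show ?thesis using Suc.IH[OF \<open>p \<le> i\<close>] \<open>p \<le> i\<close>
      by (auto simp: copy_left_def simp del: upt_Suc)
  qed auto
qed auto

lemma foldl_canonical_word:
  assumes "f \<in> ballot_maps L"
  shows "foldl copy_left id (canonical_word f L) = f"
proof -
  have f: "f x \<le> f y" if "x \<le> y" for x y using assms(1) that by (auto simp: ballot_maps_def mono_def)
  have fi: "f x \<le> x" for x using assms(1) by (auto simp: ballot_maps_def)
  \<comment> \<open>Generalised to start maps that are still the identity up to \<open>f m\<close>.
    By monotonicity this survives a longer run: the run of \<open>Suc m\<close> changes only
    positions above \<open>f (Suc m)\<close>, which is at least \<open>f m\<close>.\<close>
  have "foldl copy_left g (canonical_word f m) = (\<lambda>j. if j \<le> m then f j else g j)"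
    if "\<And>j. j \<le> f m \<Longrightarrow> g j = j" for g m
    using that
  proof (induction m arbitrary: g)
    case 0
    then show ?case using fi[of 0] by auto
  next
    case (Suc m)
    let ?g = "foldl copy_left g [Suc (f (Suc m))..<Suc (Suc m)]"
    have g: "?g j = (if f (Suc m) \<le> j \<and> j \<le> Suc m then f (Suc m) else g j)" for j
      using Suc.prems[of "f (Suc m)"] foldl_copy_left_upt[OF fi, of g "Suc m" j] by simp
    have "?g j = j" if "j \<le> f m" for j
      using that f[of m "Suc m"] Suc.prems[of j] unfolding g by auto
    from Suc.IH[OF this]
    have "foldl copy_left g (canonical_word f (Suc m)) = (\<lambda>j. if j \<le> m then f j else ?g j)"
      by (simp del: upt_Suc)
    also have "\<dots> = (\<lambda>j. if j \<le> Suc m then f j else g j)"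
      unfolding g using fi[of "Suc m"] by (auto simp: fun_eq_iff le_Suc_eq)
    finally show ?case .
  qed
  from this[of L id] show ?thesis
    using assms by (auto simp: ballot_maps_def)
qed

text \<open>The chain stays inside the ambient graph, and its words are compared in the ambient
  congruence. The numbering follows the arcs, so a piece of the path directed backwards is numbered
  from its far end; \<open>L = 0\<close> is the empty chain.\<close>

locale directed_chain =
  fixes G :: "'a pair_pre_digraph" and u :: "nat \<Rightarrow> 'a" and L :: nat
  assumes inj: "inj_on u {1..L}"
    and verts: "u ` {1..L} \<subseteq> pverts G"
    and arc: "\<And>i. i \<in> {1..<L} \<Longrightarrow> (u i, u (Suc i)) \<in> parcs G"
    and arc_only: "\<And>i j. i \<in> {1..L} \<Longrightarrow> j \<in> {1..L} \<Longrightarrow> (u i, u j) \<in> parcs G \<Longrightarrow> j = Suc i"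
begin

abbreviation cong :: "nat list \<Rightarrow> nat list \<Rightarrow> bool" (infix "\<approx>" 50) where
  "a \<approx> b \<equiv> hk_cong G (map u a) (map u b)"

lemma vert: "i \<in> {1..L} \<Longrightarrow> u i \<in> pverts G"
  using verts by auto

lemma word_in_lists: "set a \<subseteq> {1..L} \<Longrightarrow> map u a \<in> lists (pverts G)"
  unfolding in_lists_conv_set using vert by auto

lemma cong_refl: "set a \<subseteq> {1..L} \<Longrightarrow> a \<approx> a"
  by (intro hk_refl word_in_lists)

lemma cong_append:
  "a \<approx> b \<Longrightarrow> set c \<subseteq> {1..L} \<Longrightarrow> c @ a \<approx> c @ b"
  "a \<approx> b \<Longrightarrow> set c \<subseteq> {1..L} \<Longrightarrow> a @ c \<approx> b @ c"
  by (simp_all add: hk_cong_appendL hk_cong_appendR word_in_lists)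

lemma cong_commute:
  assumes "i \<in> {1..L}" "set a \<subseteq> {1..L}" "\<And>j. j \<in> set a \<Longrightarrow> Suc j < i \<or> Suc i < j"
  shows "i # a \<approx> a @ [i]"
proof -
  have "(u i, u j) \<notin> parcs G \<and> (u j, u i) \<notin> parcs G" if "j \<in> set a" for j
    using arc_only[of i j] arc_only[of j i] assms(1,2) assms(3)[OF that] that by auto
  then show ?thesis
    using hk_cong_commute_letter[OF word_in_lists[OF assms(2)] vert[OF assms(1)]] by auto
qed

text \<open>The letter commutes with the run up to \<open>j - 2\<close>, and then the relation of
  the arc from \<open>j - 1\<close> to \<open>j\<close> absorbs it; at the start of the run it is
  absorbed by idempotency.\<close>

lemma letter_run:
  assumes "p < j" "j \<le> i" "i \<le> L"
  shows "j # [Suc p..<Suc i] \<approx> [Suc p..<Suc i]"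
proof -
  have sets: "set [Suc j..<Suc i] \<subseteq> {1..L}" using assms by auto
  have split: "[Suc p..<Suc i] = [Suc p..<j] @ j # [Suc j..<Suc i]"
    using assms upt_add_eq_append[of "Suc p" j "Suc i - j"] upt_conv_Cons[of j "Suc i"]
    by (simp del: upt_Suc)
  show ?thesis
  proof (cases "j = Suc p")
    case True
    have "[j, j] \<approx> [j]" using assms by (auto intro!: hk_idem vert)
    from cong_append(2)[OF this sets] show ?thesis
      unfolding split using True by (simp del: upt_Suc)
  next
    case False
    then obtain q where q: "j = Suc q" "p < q" using assms by (cases j) auto
    have run: "[Suc p..<j] = [Suc p..<q] @ [q]" using q by simp
    have "[j, q, j] \<approx> [q, j]"
      using hk_arc2[OF _ _ arc[of q]] vert q assms by auto
    moreover have "set [Suc p..<q] \<subseteq> {1..L}" using q assms by auto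
    ultimately have 2: "[Suc p..<q] @ [j, q, j] \<approx> [Suc p..<q] @ [q, j]"
      by (rule cong_append(1))
    have "j # [Suc p..<q] \<approx> [Suc p..<q] @ [j]"
      using q assms by (intro cong_commute) auto
    from cong_append(2)[OF this, of "[q, j]"]
    have "j # [Suc p..<q] @ [q, j] \<approx> [Suc p..<q] @ [j, q, j]"
      using q assms by auto
    from cong_append(2)[OF hk_trans[OF this 2] sets]
    show ?thesis unfolding split run by (simp del: upt_Suc)
  qed
qed

text \<open>Mirror image of \<open>letter_run\<close>: the letter moves left past everything from
  \<open>j + 2\<close> on and is absorbed by the other relation of the arc from \<open>j\<close> to
  \<open>j + 1\<close>.\<close>

lemma run_letter:
  assumes "p < j" "j \<le> i" "i \<le> L"
  shows "[Suc p..<Suc i] @ [j] \<approx> [Suc p..<Suc i]"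
proof -
  have split: "[Suc p..<Suc i] = [Suc p..<j] @ j # [Suc j..<Suc i]"
    using assms upt_add_eq_append[of "Suc p" j "Suc i - j"] upt_conv_Cons[of j "Suc i"]
    by (simp del: upt_Suc)
  have sets: "set [Suc p..<j] \<subseteq> {1..L}" using assms by auto
  show ?thesis
  proof (cases "j = i")
    case True
    have "[j, j] \<approx> [j]" using assms by (auto intro!: hk_idem vert)
    from cong_append(1)[OF this sets] show ?thesis unfolding split using True by simp
  next
    case False
    then have ji: "j < i" using assms by simp
    have run: "[Suc j..<Suc i] = Suc j # [Suc (Suc j)..<Suc i]" using ji by (simp add: upt_conv_Cons del: upt_Suc)
    have "[j, Suc j, j] \<approx> [j, Suc j]"
      using hk_arc1[OF _ _ arc[of j]] vert ji assms by auto
    moreover have "set [Suc (Suc j)..<Suc i] \<subseteq> {1..L}" using assms by auto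
    ultimately have 2: "[j, Suc j, j] @ [Suc (Suc j)..<Suc i] \<approx> [j, Suc j] @ [Suc (Suc j)..<Suc i]"
      by (rule cong_append(2))
    have "j # [Suc (Suc j)..<Suc i] \<approx> [Suc (Suc j)..<Suc i] @ [j]"
      using ji assms by (intro cong_commute) auto
    moreover have "set [j, Suc j] \<subseteq> {1..L}" using ji assms by auto
    ultimately have "[j, Suc j] @ [Suc (Suc j)..<Suc i] @ [j] \<approx> [j, Suc j] @ j # [Suc (Suc j)..<Suc i]"
      by (rule cong_append(1)[OF hk_sym])
    then have "[j, Suc j] @ [Suc (Suc j)..<Suc i] @ [j] \<approx> [j, Suc j, j] @ [Suc (Suc j)..<Suc i]"
      by (simp del: upt_Suc)
    from cong_append(1)[OF hk_trans[OF this 2] sets]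
    show ?thesis unfolding split run by (simp del: upt_Suc)
  qed
qed

text \<open>A run is a zero of the submonoid generated by its letters.\<close>

lemma word_run:
  assumes "set a \<subseteq> {p<..i}" "i \<le> L"
  shows "a @ [Suc p..<Suc i] \<approx> [Suc p..<Suc i]"
  using assms(1)
proof (induction a)
  case Nil
  then show ?case using assms(2) by (auto intro!: cong_refl[simplified] simp del: upt_Suc)
next
  case (Cons j a)
  then have "a @ [Suc p..<Suc i] \<approx> [Suc p..<Suc i]" "set [j] \<subseteq> {1..L}" using assms(2) by auto
  from cong_append(1)[OF this] have "(j # a) @ [Suc p..<Suc i] \<approx> j # [Suc p..<Suc i]"
    by (simp del: upt_Suc)
  moreover have "j # [Suc p..<Suc i] \<approx> [Suc p..<Suc i]"
    using Cons.prems assms(2) by (intro letter_run) auto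
  ultimately show ?case by (rule hk_trans)
qed

lemma run_word:
  assumes "set a \<subseteq> {p<..i}" "i \<le> L"
  shows "[Suc p..<Suc i] @ a \<approx> [Suc p..<Suc i]"
  using assms(1)
proof (induction a)
  case Nil
  then show ?case using assms(2) by (auto intro!: cong_refl[simplified] simp del: upt_Suc)
next
  case (Cons j a)
  have "set a \<subseteq> {1..L}" using Cons.prems assms(2) by auto
  from cong_append(2)[OF run_letter this, of p j i]
  have "[Suc p..<Suc i] @ j # a \<approx> [Suc p..<Suc i] @ a"
    using Cons.prems assms(2) by (simp del: upt_Suc)
  moreover have "[Suc p..<Suc i] @ a \<approx> [Suc p..<Suc i]" using Cons by simp
  ultimately show ?case by (rule hk_trans)
qed

text \<open>The runs of positions above \<open>i\<close> are unaffected, which reduces the claim to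
  \<open>m = i\<close>. There \<open>i\<close> commutes past the runs of positions up to
  \<open>i - 2\<close> and lengthens the run of \<open>i - 1\<close>. The longer run starts no later
  than the old run of \<open>i\<close>, as \<open>f (i - 1) \<le> f i\<close>, so it absorbs that
  run on its left; by absorption read backwards it restores the run of \<open>i - 1\<close> on its
  right.\<close>

lemma canonical_word_letter:
  assumes f: "f \<in> ballot_maps L" and "1 \<le> i" "i \<le> m" "m \<le> L"
  shows "canonical_word f m @ [i] \<approx> canonical_word (copy_left f i) m"
  using assms(3,4)
proof (induction m rule: dec_induct)
  case base
  have mono: "f x \<le> f y" if "x \<le> y" for x y using f that by (auto simp: ballot_maps_def mono_def)
  have fi: "f x \<le> x" for x using f by (auto simp: ballot_maps_def)
  obtain r where r: "i = Suc r" using assms(2) by (cases i) auto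
  have eq: "canonical_word (copy_left f i) r = canonical_word f r"
    by (rule canonical_word_cong) (simp add: copy_left_def r)
  have i': "copy_left f i i = f r" by (simp add: copy_left_def r)
  have iL: "i \<le> L" using assms by simp
  have "[Suc (f i)..<Suc i] @ canonical_word f r @ [i] \<approx> [Suc (f r)..<Suc i] @ canonical_word f r"
  proof (cases r)
    case 0
    then have "f r = 0" using fi[of r] by simp
    then show ?thesis
      using 0 r iL word_run[of "[Suc (f i)..<Suc i]" 0 i] by auto
  next
    case (Suc s)
    let ?q = "f r" and ?c = "canonical_word f s"
    have c: "canonical_word f r = [Suc ?q..<Suc r] @ ?c" using Suc by simp
    have s: "set ?c \<subseteq> {1..L}" using set_canonical_word[of f s] Suc r iL by auto
    have sr: "set [Suc ?q..<Suc r] \<subseteq> {1..L}" "set [Suc (f i)..<Suc i] \<subseteq> {1..L}" using r iL by auto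
    have ri: "[Suc ?q..<Suc r] @ [i] = [Suc ?q..<Suc i]" using r fi[of r] by simp
    have "i # ?c \<approx> ?c @ [i]"
      using set_canonical_word[of f s] Suc r iL by (intro cong_commute) auto
    from cong_append(1)[OF hk_sym[OF this], of "[Suc (f i)..<Suc i] @ [Suc ?q..<Suc r]"]
    have 1: "[Suc (f i)..<Suc i] @ [Suc ?q..<Suc r] @ ?c @ [i] \<approx> [Suc (f i)..<Suc i] @ [Suc ?q..<Suc r] @ i # ?c"
      using sr by (simp del: upt_Suc)
    have "[Suc (f i)..<Suc i] @ [Suc ?q..<Suc i] \<approx> [Suc ?q..<Suc i]"
      using mono[of r i] r iL by (intro word_run) auto
    moreover have "[Suc ?q..<Suc i] @ [Suc ?q..<Suc r] \<approx> [Suc ?q..<Suc i]"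
      using r iL by (intro run_word) auto
    ultimately have "[Suc (f i)..<Suc i] @ [Suc ?q..<Suc i] \<approx> [Suc ?q..<Suc i] @ [Suc ?q..<Suc r]"
      using hk_sym hk_trans by blast
    from cong_append(2)[OF this s]
    have 2: "[Suc (f i)..<Suc i] @ [Suc ?q..<Suc r] @ i # ?c \<approx> [Suc ?q..<Suc i] @ [Suc ?q..<Suc r] @ ?c"
      unfolding ri[symmetric] by (simp del: upt_Suc)
    show ?thesis using hk_trans[OF 1 2] unfolding c append_assoc .
  qed
  then show ?case unfolding r canonical_word.simps using eq i' r by (simp del: upt_Suc)
next
  case (step m)
  have "set [Suc (f (Suc m))..<Suc (Suc m)] \<subseteq> {1..L}" using step by auto
  from cong_append(1)[OF step.IH this] step show ?case
    by (simp add: copy_left_def del: upt_Suc)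
qed

section \<open>Normal forms and faithfulness of the action\<close>

lemma cong_canonical_word:
  "set a \<subseteq> {1..L} \<Longrightarrow> a \<approx> canonical_word (foldl copy_left id a) L"
proof (induction a rule: rev_induct)
  case Nil
  have "canonical_word id m = []" for m by (induction m) auto
  moreover have "[] \<approx> []" by (simp add: hk_refl)
  ultimately show ?case by (simp only: foldl_Nil)
next
  case (snoc i a)
  let ?f = "foldl copy_left id a"
  have "a \<approx> canonical_word ?f L" by (rule snoc.IH) (use snoc.prems in auto)
  moreover have "set [i] \<subseteq> {1..L}" using snoc.prems by auto
  ultimately have "a @ [i] \<approx> canonical_word ?f L @ [i]" by (rule cong_append(2))
  also have "canonical_word ?f L @ [i] \<approx> canonical_word (copy_left ?f i) L"
    using snoc by (intro canonical_word_letter foldl_copy_left_ballot_maps id_ballot_maps) auto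
  finally show ?case unfolding foldl_append foldl_Cons foldl_Nil .
qed

text \<open>A derivation in the ambient graph never leaves the chain, since congruent words have the
  same letters. The start map is arbitrary so that the second factor of a product can act on the
  result of the first.\<close>

lemma foldl_copy_left_invariant:
  assumes "hk_cong G x y" "set x \<subseteq> u ` {1..L}"
  shows "foldl copy_left f (map (inv_into {1..L} u) x) = foldl copy_left f (map (inv_into {1..L} u) y)"
proof -
  have inv: "inv_into {1..L} u (u i) = i" if "i \<in> {1..L}" for i
    using inv_into_f_f[OF inj that] .
  from assms show ?thesis
  proof (induction arbitrary: f rule: hk_cong.induct)
    case (hk_idem x)
    then show ?case by (simp add: copy_left_def fun_eq_iff)
  next
    case (hk_comm x y)
    from hk_comm.prems obtain i j where ij: "x = u i" "y = u j" "i \<in> {1..L}" "j \<in> {1..L}" by auto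
    have "j \<noteq> Suc i" "i \<noteq> Suc j" using hk_comm.hyps ij arc[of i] arc[of j] by auto
    then show ?case using ij(3,4) inv unfolding ij(1,2) by (auto simp: copy_left_def fun_eq_iff)
  next
    case (hk_arc1 x y)
    from hk_arc1.prems obtain i j where ij: "x = u i" "y = u j" "i \<in> {1..L}" "j \<in> {1..L}" by auto
    then have "j = Suc i" using arc_only[of i j] hk_arc1.hyps by simp
    then show ?case using ij(3,4) inv unfolding ij(1,2) by (auto simp: copy_left_def fun_eq_iff)
  next
    case (hk_arc2 x y)
    from hk_arc2.prems obtain i j where ij: "x = u i" "y = u j" "i \<in> {1..L}" "j \<in> {1..L}" by auto
    then have "j = Suc i" using arc_only[of i j] hk_arc2.hyps by simp
    then show ?case using ij(3,4) inv unfolding ij(1,2) by (auto simp: copy_left_def fun_eq_iff)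
  next
    case (hk_sym x y)
    have "set x = set y" using hk_sym.hyps by (rule hk_cong_set)
    with hk_sym show ?case by simp
  next
    case (hk_trans x y z)
    have "set x = set y" using hk_trans.hyps(1) by (rule hk_cong_set)
    with hk_trans show ?case by simp
  qed simp_all
qed

text \<open>The relations hold for the action, and words with the same map share their canonical
  word.\<close>

lemma cong_iff:
  assumes "set a \<subseteq> {1..L}" "set b \<subseteq> {1..L}"
  shows "a \<approx> b \<longleftrightarrow> foldl copy_left id a = foldl copy_left id b"
proof
  have "map (inv_into {1..L} u) (map u c) = c" if "set c \<subseteq> {1..L}" for c
    using that inj by (induction c) auto
  then show "a \<approx> b \<Longrightarrow> foldl copy_left id a = foldl copy_left id b"
    using foldl_copy_left_invariant[of "map u a" "map u b" id] assms by auto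
  show "foldl copy_left id a = foldl copy_left id b \<Longrightarrow> a \<approx> b"
    using cong_canonical_word[OF assms(1)] cong_canonical_word[OF assms(2)] hk_sym hk_trans by metis
qed

lemma bij_betw_classes:
  assumes "W \<subseteq> lists {1..L}"
  shows "\<exists>h. bij_betw h (hk_class G ` map u ` W) (foldl copy_left id ` W)"
proof -
  have "\<exists>h. bij_betw h ((\<lambda>a. hk_class G (map u a)) ` W) (foldl copy_left id ` W)"
  proof (rule bij_betw_images_if_same_kernel)
    fix a b assume "a \<in> W" "b \<in> W"
    then have "set a \<subseteq> {1..L}" "set b \<subseteq> {1..L}" using assms by auto
    then show "hk_class G (map u a) = hk_class G (map u b) \<longleftrightarrow> foldl copy_left id a = foldl copy_left id b"
      using cong_iff hk_class_eq_iff word_in_lists by metis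
  qed
  then show ?thesis by (simp add: image_image)
qed

lemma card_chain_classes:
  shows "finite (hk_class G ` lists (u ` {1..L}))"
    and "card (hk_class G ` lists (u ` {1..L})) = catalan (Suc L)"
proof -
  have "foldl copy_left id ` lists {1..L} = ballot_maps L"
  proof
    show "foldl copy_left id ` lists {1..L} \<subseteq> ballot_maps L"
      using foldl_copy_left_ballot_maps[OF id_ballot_maps] by auto
    show "ballot_maps L \<subseteq> foldl copy_left id ` lists {1..L}"
    proof
      fix f assume "f \<in> ballot_maps L"
      from foldl_canonical_word[OF this, symmetric]
      show "f \<in> foldl copy_left id ` lists {1..L}"
        using set_canonical_word[of f L] by (intro image_eqI[where x = "canonical_word f L"]) auto
    qed
  qed
  moreover have "map u ` lists {1..L} = lists (u ` {1..L})"
    by (rule lists_image[symmetric])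
  ultimately obtain h where "bij_betw h (hk_class G ` lists (u ` {1..L})) (ballot_maps L)"
    using bij_betw_classes[of "lists {1..L}"] by auto
  then show "finite (hk_class G ` lists (u ` {1..L}))"
    and "card (hk_class G ` lists (u ` {1..L})) = catalan (Suc L)"
    using bij_betw_finite[of h] bij_betw_same_card[of h]
    by (simp_all only: finite_ballot_maps card_ballot_maps)
qed

lemma card_chain_max_content:
  assumes "L \<ge> 1"
  shows "card (content_classes G (u ` {1..L})) = catalan L"
proof -
  let ?W = "{a. set a = {1..L}}" and ?F = "{f \<in> ballot_maps L. \<forall>i\<in>{1..L}. f i < i}"
  have less: "foldl copy_left id a j < j \<longleftrightarrow> j \<in> set a" if "set a \<subseteq> {1..L}" for a j
    using foldl_copy_left_less_iff[OF id_ballot_maps that] by simp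
  have "foldl copy_left id ` ?W = ?F"
  proof
    show "foldl copy_left id ` ?W \<subseteq> ?F"
      using foldl_copy_left_ballot_maps[OF id_ballot_maps] less by auto
    show "?F \<subseteq> foldl copy_left id ` ?W"
    proof
      fix f assume f: "f \<in> ?F"
      let ?a = "canonical_word f L"
      have e: "foldl copy_left id ?a = f" using f foldl_canonical_word by auto
      have "set ?a = {1..L}"
        using f less[OF set_canonical_word, of f] set_canonical_word[of f L] unfolding e by blast
      then have "?a \<in> ?W" by simp
      then show "f \<in> foldl copy_left id ` ?W" using e[symmetric] by (rule rev_image_eqI)
    qed
  qed
  moreover have "map u ` ?W = {w. set w = u ` {1..L}}"
  proof
    show "{w. set w = u ` {1..L}} \<subseteq> map u ` ?W"
    proof
      fix w assume "w \<in> {w. set w = u ` {1..L}}"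
      then have w: "set w = u ` {1..L}" by simp
      then have "w \<in> map u ` lists {1..L}" by (auto simp: lists_image[symmetric])
      then obtain a where a: "w = map u a" "set a \<subseteq> {1..L}" by auto
      then have "u ` set a = u ` {1..L}" using w by simp
      then have "set a = {1..L}" using inj_on_image_eq_iff[OF inj a(2)] by simp
      then show "w \<in> map u ` ?W" using a by blast
    qed
  qed auto
  ultimately obtain h where "bij_betw h (content_classes G (u ` {1..L})) ?F"
    using bij_betw_classes[of ?W] by (auto simp: content_classes_def)
  then have "card (content_classes G (u ` {1..L})) = card ?F" by (rule bij_betw_same_card)
  then show ?thesis using assms card_ballot_maps_strict[of "L - 1"] by simp
qed

end


section \<open>Graphs of type A\<close>

lemma sum_split_filter:
  "finite X \<Longrightarrow> sum f X = sum f {x \<in> X. Q x} + sum f {x \<in> X. \<not> Q x}"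
  by (subst sum.union_disjoint[symmetric]) (auto intro!: sum.cong)

locale type_A_graph =
  fixes G :: "'a pair_pre_digraph" and v :: "nat \<Rightarrow> 'a" and n :: nat
  assumes type_A: "type_A G v n"
begin

definition forward :: "nat \<Rightarrow> bool" where
  "forward i \<longleftrightarrow> (v i, v (i + 1)) \<in> parcs G"

definition turning :: "nat \<Rightarrow> bool" where
  "turning j \<longleftrightarrow> is_source G (v j) \<or> is_sink G (v j)"

definition unidirectional :: "nat \<Rightarrow> nat \<Rightarrow> bool" where
  "unidirectional a b \<longleftrightarrow> 1 \<le> a \<and> b \<le> n \<and> (\<exists>d. \<forall>i\<in>{a..<b}. forward i = d)"

definition num :: "nat set \<Rightarrow> nat" where
  "num S = card (content_classes G (v ` S))"

text \<open>Finiteness is carried along because \<open>card\<close> is 0 on infinite sets, which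
  would break additivity over the contents.\<close>

definition fin :: "nat set \<Rightarrow> bool" where
  "fin S \<longleftrightarrow> finite (content_classes G (v ` S))"

lemma inj: "inj_on v {1..n}" and pverts: "pverts G = v ` {1..n}"
  using type_A by (auto simp: type_A_def)

lemma arc_cases:
  assumes "e \<in> parcs G"
  obtains i where "i \<in> {1..<n}" "e = (v i, v (Suc i)) \<or> e = (v (Suc i), v i)"
proof -
  have "parcs G \<subseteq> (\<Union>i\<in>{1..<n}. {(v i, v (Suc i)), (v (Suc i), v i)})"
    using type_A by (simp add: type_A_def)
  then have "e \<in> (\<Union>i\<in>{1..<n}. {(v i, v (Suc i)), (v (Suc i), v i)})" using assms by (rule subsetD)
  with that show thesis by blast
qed

lemma arc_iff:
  assumes "i \<in> {1..n}" "j \<in> {1..n}"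
  shows "(v i, v j) \<in> parcs G \<longleftrightarrow> j = Suc i \<and> forward i \<or> i = Suc j \<and> \<not> forward j"
proof -
  have one: "(v (Suc i), v i) \<in> parcs G \<longleftrightarrow> \<not> forward i" if "i \<in> {1..<n}" for i
    using type_A that unfolding type_A_def forward_def by auto
  have "j = Suc i \<or> i = Suc j" if arc: "(v i, v j) \<in> parcs G"
  proof -
    obtain r where r: "r \<in> {1..<n}" "(v i, v j) = (v r, v (Suc r)) \<or> (v i, v j) = (v (Suc r), v r)"
      by (rule arc_cases[OF arc])
    then have "r \<in> {1..n}" "Suc r \<in> {1..n}" by auto
    then have "i = r \<and> j = Suc r \<or> i = Suc r \<and> j = r"
      using r(2) inj_on_eq_iff[OF inj assms(1)] inj_on_eq_iff[OF inj assms(2)] by auto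
    then show ?thesis by auto
  qed
  moreover have "(v i, v j) \<in> parcs G \<longleftrightarrow> forward i" if "j = Suc i"
    using that by (simp add: forward_def)
  moreover have "(v i, v j) \<in> parcs G \<longleftrightarrow> \<not> forward j" if "i = Suc j"
    using that one[of j] assms by simp
  ultimately show ?thesis by blast
qed

text \<open>Such a vertex has an incoming and an outgoing arc, and only the two neighbours on the
  path can provide them.\<close>

lemma forward_eq_if_not_turning:
  assumes "1 < j" "j < n" "\<not> turning j"
  shows "forward (j - 1) = forward j"
proof -
  have j: "j \<in> {1..n}" "v j \<in> pverts G" using assms pverts by auto
  have arcs: "y \<in> v ` {1..n} \<and> x \<in> v ` {1..n}" if "(x, y) \<in> parcs G" for x y
    using arc_cases[OF that] by fastforce
  have "\<exists>y. (y, v j) \<in> parcs G" "\<exists>y. (v j, y) \<in> parcs G"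
    using assms(3) j by (auto simp: turning_def is_source_iff is_sink_iff)
  then obtain x y where "x \<in> {1..n}" "y \<in> {1..n}" "(v x, v j) \<in> parcs G" "(v j, v y) \<in> parcs G"
    using arcs by (metis imageE)
  then show ?thesis
    using arc_iff j by auto
qed

lemma unidirectional_if_no_turning:
  assumes "1 \<le> a" "b \<le> n" "\<And>j. a < j \<Longrightarrow> j < b \<Longrightarrow> \<not> turning j"
  shows "unidirectional a b"
proof -
  have const: "forward i = forward a" if "a \<le> i" "i < b" for i
    using that
  proof (induction i rule: dec_induct)
    case (step i)
    then have "forward i = forward (Suc i)"
      using forward_eq_if_not_turning[of "Suc i"] assms by auto
    then show ?case using step by simp
  qed simp
  have "\<forall>i\<in>{a..<b}. forward i = forward a"
    by (intro ballI const) simp_all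
  then have "\<exists>d. \<forall>i\<in>{a..<b}. forward i = d" by (rule exI)
  then show ?thesis unfolding unidirectional_def using assms(1,2) by (intro conjI)
qed

lemma unidirectional_subinterval:
  assumes "unidirectional a b" "a \<le> a'" "b' \<le> b"
  shows "unidirectional a' b'"
proof -
  have "{a'..<b'} \<subseteq> {a..<b}" using assms by auto
  then show ?thesis
    using assms unfolding unidirectional_def by (meson le_trans subsetD)
qed

lemma unidirectional_chain:
  assumes "unidirectional a b" "a \<le> Suc b"
  shows "\<exists>u. directed_chain G u (Suc b - a) \<and> u ` {1..Suc b - a} = v ` {a..b}"
proof -
  obtain d where d: "\<And>i. i \<in> {a..<b} \<Longrightarrow> forward i = d" and ab: "1 \<le> a" "b \<le> n"
    using assms unfolding unidirectional_def by blast
  \<comment> \<open>If the arcs point backwards, the vertices are numbered from \<open>b\<close>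
    downwards.\<close>
  define t where "t i = (if d then a + i - 1 else Suc b - i)" for i
  have t: "t i \<in> {a..b}" if "i \<in> {1..Suc b - a}" for i
    using that assms(2) by (auto simp: t_def)
  then have tn: "t i \<in> {1..n}" if "i \<in> {1..Suc b - a}" for i
    using that ab by fastforce
  have inj_t: "inj_on t {1..Suc b - a}"
    using assms(2) by (auto simp: t_def inj_on_def)
  have im: "t ` {1..Suc b - a} = {a..b}"
    using t card_image[OF inj_t] by (intro card_subset_eq) auto
  have "directed_chain G (v \<circ> t) (Suc b - a)"
  proof
    show "inj_on (v \<circ> t) {1..Suc b - a}"
      using inj_t inj_on_subset[OF inj, of "{a..b}"] im ab by (intro comp_inj_on) auto
    show "(v \<circ> t) ` {1..Suc b - a} \<subseteq> pverts G"
      using tn pverts by auto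
  next
    fix i assume i: "i \<in> {1..<Suc b - a}"
    then have ii: "i \<in> {1..Suc b - a}" "Suc i \<in> {1..Suc b - a}" by auto
    have "(if d then t (Suc i) = Suc (t i) \<and> t i \<in> {a..<b} else t i = Suc (t (Suc i)) \<and> t (Suc i) \<in> {a..<b})"
      using i assms(2) ab by (auto simp: t_def)
    then show "((v \<circ> t) i, (v \<circ> t) (Suc i)) \<in> parcs G"
      using arc_iff[OF tn[OF ii(1)] tn[OF ii(2)]] d[of "t i"] d[of "t (Suc i)"]
      by (auto split: if_splits)
  next
    fix i j assume i: "i \<in> {1..Suc b - a}" and j: "j \<in> {1..Suc b - a}"
      and arc: "((v \<circ> t) i, (v \<circ> t) j) \<in> parcs G"
    then consider "t j = Suc (t i)" "forward (t i)" | "t i = Suc (t j)" "\<not> forward (t j)"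
      using arc_iff[OF tn[OF i] tn[OF j]] by auto
    then show "j = Suc i"
    proof cases
      case 1
      then have "d" using d[of "t i"] t[OF i] t[OF j] by auto
      then show ?thesis using 1 i j ab by (auto simp: t_def)
    next
      case 2
      then have "\<not> d" using d[of "t j"] t[OF i] t[OF j] by auto
      then show ?thesis using 2 i j ab by (auto simp: t_def)
    qed
  qed
  moreover have "(v \<circ> t) ` {1..Suc b - a} = v ` {a..b}"
    using im by (metis image_comp)
  ultimately show ?thesis by blast
qed

lemma fin_unidirectional:
  assumes "unidirectional a b" "a \<le> Suc b" "S \<subseteq> {a..b}"
  shows "fin S"
proof -
  obtain u where u: "directed_chain G u (Suc b - a)" "u ` {1..Suc b - a} = v ` {a..b}"
    using unidirectional_chain[OF assms(1,2)] by blast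
  have "finite (hk_class G ` lists (v ` {a..b}))"
    using directed_chain.card_chain_classes(1)[OF u(1)] u(2) by simp
  moreover have "content_classes G (v ` S) \<subseteq> hk_class G ` lists (v ` {a..b})"
  proof -
    have "v ` S \<subseteq> v ` {a..b}" using assms(3) by (rule image_mono)
    then show ?thesis unfolding content_classes_def by (intro image_mono) auto
  qed
  ultimately show ?thesis unfolding fin_def by (rule finite_subset[rotated])
qed

section \<open>Enumeration by content\<close>

lemma card_classes_interval:
  assumes "1 \<le> a" "b \<le> n" "\<And>S. S \<subseteq> {a..b} \<Longrightarrow> fin S"
  shows "card (hk_class G ` lists (v ` {a..b})) = sum num (Pow {a..b})"
proof -
  have inj': "inj_on v {a..b}" using inj assms by (auto intro: inj_on_subset)
  have "card (hk_class G ` lists (v ` {a..b})) = (\<Sum>T\<in>Pow (v ` {a..b}). card (content_classes G T))"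
  proof (rule card_classes_lists)
    show "v ` {a..b} \<subseteq> pverts G" using pverts assms by auto
    fix T assume "T \<subseteq> v ` {a..b}"
    then obtain S where "S \<subseteq> {a..b}" "T = v ` S" by (auto simp: subset_image_iff)
    then show "finite (content_classes G T)" using assms(3) by (simp add: fin_def)
  qed simp
  also have "Pow (v ` {a..b}) = (`) v ` Pow {a..b}" by (simp add: image_Pow_surj)
  also have "(\<Sum>T\<in>(`) v ` Pow {a..b}. card (content_classes G T)) = sum num (Pow {a..b})"
    using inj_on_image_Pow[OF inj'] by (subst sum.reindex) (auto simp: num_def)
  finally show ?thesis .
qed

text \<open>Summing over all contents counts every ballot map; the Catalan differences of the
  coefficients all derive from this total.\<close>

lemma sum_num_unidirectional:
  assumes "unidirectional a b" "a \<le> Suc b"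
  shows "sum num (Pow {a..b}) = catalan (Suc (Suc b - a))"
proof -
  obtain u where u: "directed_chain G u (Suc b - a)" "u ` {1..Suc b - a} = v ` {a..b}"
    using unidirectional_chain[OF assms] by blast
  have "1 \<le> a" "b \<le> n" using assms unfolding unidirectional_def by blast+
  from card_classes_interval[OF this] show ?thesis
    using directed_chain.card_chain_classes(2)[OF u(1)] u(2) fin_unidirectional[OF assms] by simp
qed

lemma num_interval_unidirectional:
  assumes "unidirectional a b" "a \<le> b"
  shows "num {a..b} = catalan (Suc b - a)"
proof -
  obtain u where u: "directed_chain G u (Suc b - a)" "u ` {1..Suc b - a} = v ` {a..b}"
    using unidirectional_chain[of a b] assms by auto
  then show ?thesis
    using directed_chain.card_chain_max_content[OF u(1)] assms by (simp add: num_def)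
qed

text \<open>The two parts of \<open>S\<close> meet in \<open>a\<close> or not at all, according to
  whether \<open>a \<in> S\<close>; each case has its own factorisation.\<close>

lemma
  assumes "turning a" "1 \<le> a" "S \<subseteq> {1..n}"
  shows num_cut: "num S = num (S \<inter> {..a}) * num (S \<inter> {a..})"
    and fin_cut: "fin (S \<inter> {..a}) \<Longrightarrow> fin (S \<inter> {a..}) \<Longrightarrow> fin S"
proof -
  let ?A = "S \<inter> {..a}" and ?B = "S \<inter> {a..}"
  have S: "v ` S = v ` ?A \<union> v ` ?B" by (force simp: image_Un[symmetric])
  have sub: "v ` ?A \<union> v ` ?B \<subseteq> pverts G" using assms(3) pverts by auto
  have no: "(v i, v j) \<notin> parcs G \<and> (v j, v i) \<notin> parcs G"
    if "i \<in> ?A" "j \<in> ?B" "i \<noteq> a" "j \<noteq> a" for i j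
  proof -
    have "i \<in> {1..n}" "j \<in> {1..n}" "i < a" "a < j" using that assms(3) by auto
    then show ?thesis using arc_iff[of i j] arc_iff[of j i] by auto
  qed
  have "\<exists>h. bij_betw h (content_classes G (v ` S)) (content_classes G (v ` ?A) \<times> content_classes G (v ` ?B))"
    unfolding S
  proof (cases "a \<in> S")
    case True
    have "v ` ?A \<inter> v ` ?B = v ` (?A \<inter> ?B)"
      using assms(3) by (intro inj_on_image_Int[OF inj, symmetric]) auto
    also have "?A \<inter> ?B = {a}" using True by auto
    finally have int: "v ` ?A \<inter> v ` ?B = {v a}" by simp
    show "\<exists>h. bij_betw h (content_classes G (v ` ?A \<union> v ` ?B)) (content_classes G (v ` ?A) \<times> content_classes G (v ` ?B))"
      by (rule content_classes_cut[OF sub int assms(1)[unfolded turning_def]]) (use no in blast)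
  next
    case False
    have "v ` ?A \<inter> v ` ?B = v ` (?A \<inter> ?B)"
      using assms(3) by (intro inj_on_image_Int[OF inj, symmetric]) auto
    also have "?A \<inter> ?B = {}" using False by auto
    finally have int: "v ` ?A \<inter> v ` ?B = {}" by simp
    show "\<exists>h. bij_betw h (content_classes G (v ` ?A \<union> v ` ?B)) (content_classes G (v ` ?A) \<times> content_classes G (v ` ?B))"
      by (rule content_classes_disjoint[OF sub int]) (use no False in blast)
  qed
  then obtain h where h: "bij_betw h (content_classes G (v ` S)) (content_classes G (v ` ?A) \<times> content_classes G (v ` ?B))"
    by blast
  show "num S = num ?A * num ?B"
    unfolding num_def using bij_betw_same_card[OF h] by (simp add: card_cartesian_product)
  show "fin ?A \<Longrightarrow> fin ?B \<Longrightarrow> fin S"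
    unfolding fin_def using bij_betw_finite[OF h] by simp
qed

text \<open>The two values at \<open>b\<close> form the state vector of the transfer matrix
  method.\<close>

definition prefix_sum :: "nat \<Rightarrow> bool \<Rightarrow> nat" where
  "prefix_sum b e = sum num {S \<in> Pow {1..b}. (b \<in> S) = e}"

definition transfer :: "nat \<Rightarrow> nat \<Rightarrow> bool \<Rightarrow> bool \<Rightarrow> nat" where
  "transfer a b d e = sum num {T \<in> Pow {a..b}. (a \<in> T) = d \<and> (b \<in> T) = e}"

lemma prefix_sum_step:
  assumes "turning a" "1 \<le> a" "a < b" "b \<le> n"
  shows "prefix_sum b e = prefix_sum a False * transfer a b False e + prefix_sum a True * transfer a b True e"
proof -
  have *: "sum num {S \<in> {S \<in> Pow {1..b}. (b \<in> S) = e}. (a \<in> S) = d} = prefix_sum a d * transfer a b d e" for d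
  proof -
    let ?X = "{S \<in> Pow {1..a}. (a \<in> S) = d}" and ?Y = "{T \<in> Pow {a..b}. (a \<in> T) = d \<and> (b \<in> T) = e}"
    have "sum num {S \<in> {S \<in> Pow {1..b}. (b \<in> S) = e}. (a \<in> S) = d} = (\<Sum>(S, T)\<in>?X \<times> ?Y. num S * num T)"
    \<comment> \<open>Contents on both sides can be glued because they agree on \<open>a\<close>:
      both contain it or neither does, as recorded by \<open>d\<close>.\<close>
    proof (rule sum.reindex_bij_witness[of _ "\<lambda>(S, T). S \<union> T" "\<lambda>S. (S \<inter> {..a}, S \<inter> {a..})"])
      fix S assume "S \<in> {S \<in> {S \<in> Pow {1..b}. (b \<in> S) = e}. (a \<in> S) = d}"
      moreover from this have "S \<subseteq> {1..n}" using assms(4) by auto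
      ultimately show "(case (S \<inter> {..a}, S \<inter> {a..}) of (S, T) \<Rightarrow> S \<union> T) = S"
        "(S \<inter> {..a}, S \<inter> {a..}) \<in> ?X \<times> ?Y"
        "(case (S \<inter> {..a}, S \<inter> {a..}) of (S, T) \<Rightarrow> num S * num T) = num S"
        using assms num_cut[OF assms(1,2), of S] by auto
    next
      fix c assume "c \<in> ?X \<times> ?Y"
      then obtain S T where c: "c = (S, T)" "S \<subseteq> {1..a}" "(a \<in> S) = d" "T \<subseteq> {a..b}" "(a \<in> T) = d" "(b \<in> T) = e"
        by auto
      have "x \<in> S \<longleftrightarrow> x \<in> T" if "x = a" for x using c that by simp
      then have "T \<inter> {..a} \<subseteq> S" "S \<inter> {a..} \<subseteq> T"
        using c(2,4) by (fastforce dest: subsetD)+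
      moreover have "S \<subseteq> {..a}" "T \<subseteq> {a..}" using c(2,4) by auto
      ultimately have "(S \<union> T) \<inter> {..a} = S" "(S \<union> T) \<inter> {a..} = T" by blast+
      then show "((case c of (S, T) \<Rightarrow> S \<union> T) \<inter> {..a}, (case c of (S, T) \<Rightarrow> S \<union> T) \<inter> {a..}) = c"
        using c by simp
      show "(case c of (S, T) \<Rightarrow> S \<union> T) \<in> {S \<in> {S \<in> Pow {1..b}. (b \<in> S) = e}. (a \<in> S) = d}"
        using c assms by auto
    qed
    also have "\<dots> = prefix_sum a d * transfer a b d e"
      unfolding prefix_sum_def transfer_def
      by (simp add: sum_product sum.cartesian_product)
    finally show ?thesis .
  qed
  show ?thesis
    unfolding *[symmetric] unfolding prefix_sum_def
    by (subst sum_split_filter[of _ _ "\<lambda>S. a \<notin> S"]) auto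
qed

text \<open>Inclusion-exclusion over the ends: the totals for \<open>m\<close>, \<open>m - 1\<close>
  and \<open>m - 2\<close> vertices are the Catalan numbers of index \<open>m + 1\<close>,
  \<open>m\<close> and \<open>m - 1\<close>.\<close>

lemma transfer_unidirectional:
  assumes "unidirectional a b" "a < b"
  defines "m \<equiv> Suc b - a"
  shows "transfer a b False False = catalan (m - 1)"
    and "int (transfer a b True False) = int (catalan m) - int (catalan (m - 1))"
    and "int (transfer a b False True) = int (catalan m) - int (catalan (m - 1))"
    and "int (transfer a b True True) = int (catalan (m + 1)) - 2 * int (catalan m) + int (catalan (m - 1))"
proof -
  have total: "sum num (Pow {a'..b'}) = catalan (Suc (Suc b' - a'))"
    if "a \<le> a'" "b' \<le> b" "a' \<le> Suc b'" for a' b'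
    using sum_num_unidirectional[OF unidirectional_subinterval[OF assms(1) that(1,2)] that(3)] .
  have D: "{Suc a..b - 1} = {a..b} - {a, b}" "{a..b - 1} = {a..b} - {b}" "{Suc a..b} = {a..b} - {a}"
    using assms(2) by auto
  have "transfer a b False False = sum num (Pow {Suc a..b - 1})"
    unfolding transfer_def D by (intro sum.cong) auto
  then show FF: "transfer a b False False = catalan (m - 1)"
    using total[of "Suc a" "b - 1"] assms(2) by (simp add: m_def Suc_diff_Suc)
  have "sum num (Pow {a..b - 1}) = transfer a b True False + transfer a b False False"
    unfolding transfer_def D
    by (subst sum_split_filter[of _ _ "\<lambda>S. a \<in> S"]) (auto intro!: arg_cong2[of _ _ _ _ "(+)"] sum.cong)
  with total[of a "b - 1"] FF assms(2)
  show TF: "int (transfer a b True False) = int (catalan m) - int (catalan (m - 1))"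
    by (simp add: m_def Suc_diff_le)
  have "sum num (Pow {Suc a..b}) = transfer a b False True + transfer a b False False"
    unfolding transfer_def D
    by (subst sum_split_filter[of _ _ "\<lambda>S. b \<in> S"]) (auto intro!: arg_cong2[of _ _ _ _ "(+)"] sum.cong)
  with total[of "Suc a" b] FF assms(2)
  show FT: "int (transfer a b False True) = int (catalan m) - int (catalan (m - 1))"
    by (simp add: m_def Suc_diff_le)
  have "sum num (Pow {a..b}) = sum num {S \<in> Pow {a..b}. a \<in> S} + sum num {S \<in> Pow {a..b}. a \<notin> S}"
    by (rule sum_split_filter) simp
  also have "sum num {S \<in> Pow {a..b}. a \<in> S} = transfer a b True True + transfer a b True False"
    unfolding transfer_def by (subst sum_split_filter[of _ _ "\<lambda>S. b \<in> S"]) (auto intro!: arg_cong2[of _ _ _ _ "(+)"] sum.cong)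
  also have "sum num {S \<in> Pow {a..b}. a \<notin> S} = transfer a b False True + transfer a b False False"
    unfolding transfer_def by (subst sum_split_filter[of _ _ "\<lambda>S. b \<in> S"]) (auto intro!: arg_cong2[of _ _ _ _ "(+)"] sum.cong)
  finally show "int (transfer a b True True) = int (catalan (m + 1)) - 2 * int (catalan m) + int (catalan (m - 1))"
    using total[of a b] FF TF FT assms(2) by (simp add: m_def Suc_diff_le)
qed

end

section \<open>Paths with a sequence of cuts\<close>

lemma catalan_small: "catalan 1 = 1" "catalan 2 = 2" "catalan 3 = 5"
proof -
  have "(4::nat) choose 2 = 6" "(6::nat) choose 3 = 20" by (simp_all add: eval_nat_numeral)
  then show "catalan 2 = 2" "catalan 3 = 5" by (simp_all add: catalan_def)
  show "catalan 1 = 1" using catalan_exact[of 1] by simp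
qed

lemma hk_coeff_cong:
  assumes "i - 1 \<in> Q \<longleftrightarrow> i - 1 \<in> R" "i \<in> Q \<longleftrightarrow> i \<in> R" "1 \<le> i" "i \<le> k"
  shows "hk_coeff k l Q i = hk_coeff k l R i"
  using assms by (auto simp: hk_coeff_def Let_def)

text \<open>The cuts are abstract so that two sequences fit: the list of all sources and sinks for
  \<open>n \<ge> 2\<close>, and the sequence of all vertices in the alternating case, where
  \<open>n = 1\<close> gives \<open>M = 0\<close>.\<close>

locale cut_path = type_A_graph +
  fixes p :: "nat \<Rightarrow> nat" and M :: nat
  assumes first: "p 0 = 1" and last: "p M = n"
    and less_Suc: "\<And>i. i < M \<Longrightarrow> p i < p (Suc i)"
    and turning_p: "\<And>i. i < M \<Longrightarrow> turning (p i)"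
    and unidirectional_p: "\<And>i. i < M \<Longrightarrow> unidirectional (p i) (p (Suc i))"
begin

lemma p_mono: "i \<le> j \<Longrightarrow> j \<le> M \<Longrightarrow> p i \<le> p j"
proof (induction j rule: dec_induct)
  case (step j)
  then show ?case using less_Suc[of j] by simp
qed simp

lemma p_ge_1: "i \<le> M \<Longrightarrow> 1 \<le> p i"
  using p_mono[of 0 i] first by simp

lemma p_le_n: "i \<le> M \<Longrightarrow> p i \<le> n"
  using p_mono[of i M] last by simp

lemma prefix_sum_Suc:
  assumes "m < M"
  shows "prefix_sum (p (Suc m)) e =
    prefix_sum (p m) False * transfer (p m) (p (Suc m)) False e +
    prefix_sum (p m) True * transfer (p m) (p (Suc m)) True e"
  using assms by (intro prefix_sum_step turning_p p_ge_1 less_Suc p_le_n) auto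

lemma prefix_sum_first: "prefix_sum (p 0) e = 1"
proof -
  have n: "1 \<le> n" using p_le_n[of 0] first by simp
  have e: "num {} = 1"
    using sum_num_unidirectional[of 1 0] catalan_small(1) by (simp add: unidirectional_def)
  have o: "num {1} = 1"
    using num_interval_unidirectional[of 1 1] n catalan_small(1) by (simp add: unidirectional_def)
  have "{S \<in> Pow {1..1}. (1 \<in> S) = e} = {if e then {1::nat} else {}}"
    by (auto simp: subset_singleton_iff)
  then show ?thesis using e o by (simp add: prefix_sum_def first)
qed

lemma fin_prefix: "m \<le> M \<Longrightarrow> S \<subseteq> {1..p m} \<Longrightarrow> fin S"
proof (induction m arbitrary: S)
  case 0
  have "unidirectional 1 1" using p_le_n[of 0] first by (simp add: unidirectional_def)
  then show ?case using fin_unidirectional[of 1 1 S] 0 first by simp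
next
  case (Suc m)
  have m: "m < M" using Suc.prems by simp
  show ?case
  proof (rule fin_cut[OF turning_p[OF m]])
    show "1 \<le> p m" "S \<subseteq> {1..n}" using Suc.prems p_ge_1[of m] p_le_n[of "Suc m"] by auto
    show "fin (S \<inter> {..p m})" using Suc.prems by (intro Suc.IH) auto
    show "fin (S \<inter> {p m..})"
      using Suc.prems less_Suc[OF m] by (intro fin_unidirectional[OF unidirectional_p[OF m]]) auto
  qed
qed

lemma card_carrier: "card (carrier (HK G)) = prefix_sum n False + prefix_sum n True"
proof -
  have "card (carrier (HK G)) = sum num (Pow {1..n})"
    unfolding carrier_HK pverts
    by (rule card_classes_interval) (use fin_prefix[of M] last in auto)
  also have "\<dots> = prefix_sum n False + prefix_sum n True"
    unfolding prefix_sum_def by (subst sum_split_filter[of _ _ "\<lambda>S. n \<notin> S"]) simp_all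
  finally show ?thesis .
qed

text \<open>Full content contains every cut, so each cut splits off one directed piece with both of
  its ends included.\<close>

lemma num_prefix: "m \<le> M \<Longrightarrow> num {1..p m} = (\<Prod>i = 1..m. catalan (Suc (p i) - p (i - 1)))"
proof (induction m)
  case 0
  have "unidirectional 1 1" using p_le_n[of 0] first by (simp add: unidirectional_def)
  then show ?case using num_interval_unidirectional[of 1 1] catalan_small(1) by (simp add: first)
next
  case (Suc m)
  have m: "m < M" using Suc.prems by simp
  have cut: "{1..p (Suc m)} \<inter> {..p m} = {1..p m}" "{1..p (Suc m)} \<inter> {p m..} = {p m..p (Suc m)}"
    using less_Suc[OF m] p_ge_1[of m] m by auto
  have "num {1..p (Suc m)} = num {1..p m} * num {p m..p (Suc m)}"
    unfolding cut[symmetric] using p_ge_1[of m] p_le_n[of "Suc m"] m by (intro num_cut turning_p) auto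
  moreover have "num {p m..p (Suc m)} = catalan (Suc (p (Suc m)) - p m)"
    using less_Suc[OF m] by (intro num_interval_unidirectional unidirectional_p m) simp
  ultimately show ?case using Suc m by simp
qed

lemma card_max_content: "card (max_content G) = (\<Prod>i = 1..M. catalan (Suc (p i) - p (i - 1)))"
  using num_prefix[of M] last by (simp add: max_content_eq num_def pverts)

section \<open>The sum over the sets Q\<close>

context
  fixes k :: nat and l :: "nat \<Rightarrow> nat"
  assumes M: "M = k + 1" and k: "k \<ge> 1"
    and l: "\<And>i. i \<in> {1..M} \<Longrightarrow> l i = Suc (p i) - p (i - 1)"
begin

lemmas transfer_p = transfer_unidirectional[OF unidirectional_p less_Suc]

text \<open>The state vector at the first vertex is (1, 1), so the first coefficient adds the
  transfer entries for both states of the left end, and two Catalan terms cancel.\<close>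

lemma hk_coeff_first: "hk_coeff k l Q 1 = int (prefix_sum (p 1) (1 \<in> Q))"
proof -
  have "0 < M" using M by simp
  then show ?thesis
    using prefix_sum_Suc[of 0 "1 \<in> Q"] prefix_sum_first transfer_p[of 0] l[of 1]
    by (cases "1 \<in> Q") (simp_all add: hk_coeff_def)
qed

lemma hk_coeff_Suc:
  assumes "1 \<le> i" "i < k"
  shows "hk_coeff k l Q (Suc i) = int (transfer (p i) (p (Suc i)) (i \<in> Q) (Suc i \<in> Q))"
  using transfer_p[of i] assms M l[of "Suc i"]
  by (cases "i \<in> Q"; cases "Suc i \<in> Q") (simp_all add: hk_coeff_def)

lemma hk_coeff_last:
  "hk_coeff k l Q (k + 1) =
    int (transfer (p k) (p (k + 1)) (k \<in> Q) False) + int (transfer (p k) (p (k + 1)) (k \<in> Q) True)"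
  using transfer_p[of k] M k l[of "k + 1"]
  by (cases "k \<in> Q") (simp_all add: hk_coeff_def)

text \<open>Expansion of the matrix product: a choice of states at the cuts 1 to \<open>m\<close> is
  a set \<open>Q\<close>, and its weight is the product of the entries passed.\<close>

lemma prefix_sum_eq_sum_hk_coeff:
  assumes "1 \<le> m" "m \<le> k"
  shows "int (prefix_sum (p m) e) = (\<Sum>Q | Q \<in> Pow {1..m} \<and> (m \<in> Q) = e. \<Prod>i = 1..m. hk_coeff k l Q i)"
  using assms
proof (induction m arbitrary: e rule: dec_induct)
  case base
  have "{Q. Q \<in> Pow {1..1} \<and> (1 \<in> Q) = e} = {if e then {1::nat} else {}}"
    by (auto simp: subset_singleton_iff)
  then show ?case using hk_coeff_first by simp
next
  case (step m)
  let ?X = "\<lambda>m e. {Q. Q \<in> Pow {1..m} \<and> (m \<in> Q) = e}"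
  let ?P = "\<lambda>Q. \<Prod>i = 1..m. hk_coeff k l Q i"
  let ?t = "\<lambda>d. int (transfer (p m) (p (Suc m)) d e)"
  let ?ext = "\<lambda>Q. if e then insert (Suc m) Q else Q"
  have "(\<Sum>Q\<in>?X (Suc m) e. \<Prod>i = 1..Suc m. hk_coeff k l Q i) = (\<Sum>Q\<in>Pow {1..m}. ?P Q * ?t (m \<in> Q))"
  \<comment> \<open>Membership of \<open>Suc m\<close> is dictated by \<open>e\<close>, so only the
    part of \<open>Q\<close> below it is free.\<close>
  proof (rule sum.reindex_bij_witness[of _ ?ext "\<lambda>Q. Q - {Suc m}"])
    fix Q assume Q: "Q \<in> ?X (Suc m) e"
    have "?P (Q - {Suc m}) = ?P Q"
      using step.prems by (intro prod.cong hk_coeff_cong) auto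
    moreover have "hk_coeff k l Q (Suc m) = ?t (m \<in> Q)"
      using hk_coeff_Suc[of m Q] Q step by simp
    ultimately show "?P (Q - {Suc m}) * ?t (m \<in> Q - {Suc m}) = (\<Prod>i = 1..Suc m. hk_coeff k l Q i)"
      by simp
  qed (auto simp: le_Suc_eq subset_iff split: if_splits)
  also have "\<dots> = (\<Sum>Q\<in>{Q \<in> Pow {1..m}. m \<notin> Q}. ?P Q * ?t (m \<in> Q)) + (\<Sum>Q\<in>{Q \<in> Pow {1..m}. \<not> m \<notin> Q}. ?P Q * ?t (m \<in> Q))"
    by (rule sum_split_filter) simp
  also have "\<dots> = (\<Sum>Q\<in>?X m False. ?P Q * ?t False) + (\<Sum>Q\<in>?X m True. ?P Q * ?t True)"
    by (intro arg_cong2[of _ _ _ _ "(+)"] sum.cong) auto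
  also have "\<dots> = int (prefix_sum (p (Suc m)) e)"
    using prefix_sum_Suc[of m e] step M by (simp add: sum_distrib_right)
  finally show ?case by simp
qed

lemma card_carrier_eq_sum_hk_coeff:
  "int (card (carrier (HK G))) = (\<Sum>Q\<in>Pow {1..k}. \<Prod>i = 1..k + 1. hk_coeff k l Q i)"
proof -
  let ?X = "\<lambda>e. {Q. Q \<in> Pow {1..k} \<and> (k \<in> Q) = e}"
  let ?P = "\<lambda>Q. \<Prod>i = 1..k. hk_coeff k l Q i"
  let ?t = "\<lambda>d. int (transfer (p k) (p (k + 1)) d False) + int (transfer (p k) (p (k + 1)) d True)"
  have "(\<Sum>Q\<in>Pow {1..k}. \<Prod>i = 1..k + 1. hk_coeff k l Q i) = (\<Sum>Q\<in>Pow {1..k}. ?P Q * ?t (k \<in> Q))"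
    using hk_coeff_last by simp
  also have "\<dots> = (\<Sum>Q\<in>{Q \<in> Pow {1..k}. k \<notin> Q}. ?P Q * ?t (k \<in> Q)) + (\<Sum>Q\<in>{Q \<in> Pow {1..k}. \<not> k \<notin> Q}. ?P Q * ?t (k \<in> Q))"
    by (rule sum_split_filter) simp
  also have "\<dots> = (\<Sum>Q\<in>?X False. ?P Q * ?t False) + (\<Sum>Q\<in>?X True. ?P Q * ?t True)"
    by (intro arg_cong2[of _ _ _ _ "(+)"] sum.cong) auto
  also have "\<dots> = int (prefix_sum (p k) False) * ?t False + int (prefix_sum (p k) True) * ?t True"
    using prefix_sum_eq_sum_hk_coeff[of k] k by (simp only: sum_distrib_right[symmetric])
  also have "\<dots> = int (card (carrier (HK G)))"
    using card_carrier prefix_sum_Suc[of k] M last by (simp add: algebra_simps)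
  finally show ?thesis by simp
qed

end

end

section \<open>Two concrete sequences of cuts\<close>

context type_A_graph
begin

lemma card_carrier_fib:
  assumes "n \<ge> 1" "\<And>j. j \<in> {1..n} \<Longrightarrow> turning j"
  shows "card (carrier (HK G)) = fib (2 * n + 1)"
proof -
  interpret cut_path G v n Suc "n - 1"
  proof
    fix i assume "i < n - 1"
    then show "unidirectional (Suc i) (Suc (Suc i))" by (auto simp: unidirectional_def)
  qed (use assms in auto)
  \<comment> \<open>Each step takes (x, y) to (x + y, x + 2 y), which moves a pair of consecutive
    Fibonacci numbers two places on. At \<open>m = n - 1\<close> the pair sums to
    \<open>fib (2 * n + 1)\<close>.\<close>
  have "prefix_sum (Suc m) False = fib (2 * m + 1) \<and> prefix_sum (Suc m) True = fib (2 * m + 2)"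
    if "m \<le> n - 1" for m
    using that
  proof (induction m)
    case 0
    then show ?case using prefix_sum_first by simp
  next
    case (Suc m)
    then have m: "m < n - 1" by simp
    have "catalan (Suc 0) = 1" using catalan_small(1) by simp
    then have "transfer (Suc m) (Suc (Suc m)) False False = 1" "transfer (Suc m) (Suc (Suc m)) True False = 1"
      "transfer (Suc m) (Suc (Suc m)) False True = 1" "transfer (Suc m) (Suc (Suc m)) True True = 2"
      using transfer_unidirectional[OF unidirectional_p[OF m]] catalan_small by (simp_all add: numeral_eq_Suc)
    then show ?case using prefix_sum_Suc[OF m] Suc by simp
  qed
  from this[of "n - 1"] card_carrier assms(1) show ?thesis
    by (cases n) simp_all
qed

lemma turning_positions:
  assumes "n \<ge> 2"
  defines "ps \<equiv> source_sink_positions G v n"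
  shows "cut_path G v n ((!) ps) (num_internal G v n + 1)"
proof -
  let ?k = "num_internal G v n"
  note ends = source_sink_positions_ends[OF type_A assms(1), folded ps_def]
  have len: "length ps = ?k + 2" using ends(1) by (simp add: num_internal_def ps_def)
  then have ne: "ps \<noteq> []" by auto
  have sorted: "sorted_wrt (<) ps"
    unfolding ps_def source_sink_positions_def by (intro sorted_wrt_filter) (rule sorted_wrt_upt)
  have set: "set ps = {j \<in> {1..n}. turning j}"
    by (auto simp: ps_def source_sink_positions_def turning_def)
  show ?thesis
  proof
    show "ps ! 0 = 1" using ends(2) ne by (simp add: hd_conv_nth)
    show "ps ! (?k + 1) = n" using ends(3) ne len by (simp add: last_conv_nth)
    fix i assume i: "i < ?k + 1"
    show "ps ! i < ps ! Suc i" using sorted_wrt_nth_less[OF sorted, of i "Suc i"] i len by simp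
    have mem: "ps ! i \<in> set ps" "ps ! Suc i \<in> set ps" using i len by auto
    then show "turning (ps ! i)" using set by blast
    show "unidirectional (ps ! i) (ps ! Suc i)"
    proof (rule unidirectional_if_no_turning)
      show "1 \<le> ps ! i" "ps ! Suc i \<le> n" using mem set by auto
      fix j assume j: "ps ! i < j" "j < ps ! Suc i"
      show "\<not> turning j"
      proof
        assume "turning j"
        \<comment> \<open>The list is strictly increasing and complete, so the index of
          \<open>j\<close> would lie strictly between \<open>i\<close> and
          \<open>Suc i\<close>.\<close>
        then have "j \<in> set ps" using j mem set by auto
        then obtain r where r: "r < length ps" "ps ! r = j" by (auto simp: in_set_conv_nth)
        then have "i < r" "r < Suc i"
          using j sorted_wrt_nth_less[OF sorted, of r i] sorted_wrt_nth_less[OF sorted, of "Suc i" r] i len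
          by (metis linorder_neqE_nat not_less_iff_gr_or_eq less_trans add_2_eq_Suc' Suc_eq_plus1 less_SucI Suc_less_eq)+
        then show False by simp
      qed
    qed
  qed
qed

end

theorem corollary4p8:
  fixes G :: "'a pair_pre_digraph" and v :: "nat \<Rightarrow> 'a" and n k :: nat and l :: "nat \<Rightarrow> nat"
  assumes "type_A G v n"
    and "k = num_internal G v n"
    and "l = (\<lambda>i. card (verts (segment G v n i)))"
  shows "(n \<ge> 2 \<longrightarrow> card (max_content G) = (\<Prod>i = 1..k + 1. catalan (l i))) \<and>
         (n \<ge> 2 \<longrightarrow> k \<ge> 1 \<longrightarrow>
            int (card (carrier (HK G))) = (\<Sum>Q\<in>Pow {1..k}. \<Prod>i = 1..k + 1. hk_coeff k l Q i)) \<and>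
         (n \<ge> 1 \<longrightarrow> (\<forall>x\<in>pverts G. is_source G x \<or> is_sink G x) \<longrightarrow>
            card (carrier (HK G)) = fib (2 * n + 1))"
proof -
  interpret type_A_graph G v n using assms(1) by unfold_locales
  let ?p = "(!) (source_sink_positions G v n)"
  have path: "cut_path G v n ?p (k + 1)" if "n \<ge> 2"
    using turning_positions[OF that] assms(2) by simp
  have l: "l i = Suc (?p i) - ?p (i - 1)" if "n \<ge> 2" "i \<in> {1..k + 1}" for i
  proof -
    interpret cut_path G v n ?p "k + 1" using path[OF that(1)] .
    have "1 \<le> ?p (i - 1)" "?p i \<le> n" using p_ge_1[of "i - 1"] p_le_n[of i] that(2) by auto
    then have "inj_on v {?p (i - 1)..?p i}" by (intro inj_on_subset[OF inj]) auto
    then show ?thesis by (simp add: assms(3) segment_def card_image)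
  qed
  have 1: "card (max_content G) = (\<Prod>i = 1..k + 1. catalan (l i))" if "n \<ge> 2"
    using cut_path.card_max_content[OF path[OF that]] l[OF that] by simp
  have 2: "int (card (carrier (HK G))) = (\<Sum>Q\<in>Pow {1..k}. \<Prod>i = 1..k + 1. hk_coeff k l Q i)"
    if "n \<ge> 2" "k \<ge> 1"
    using cut_path.card_carrier_eq_sum_hk_coeff[OF path[OF that(1)] refl that(2) l[OF that(1)]] .
  have 3: "card (carrier (HK G)) = fib (2 * n + 1)"
    if "n \<ge> 1" "\<forall>x\<in>pverts G. is_source G x \<or> is_sink G x"
    using that by (intro card_carrier_fib) (auto simp: turning_def pverts)
  show ?thesis using 1 2 3 by (intro conjI impI)
qed

end
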